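(* Let $\sigma>0$ be a constant and let $\dot W$ be a space-time white noise on $\mathbf{R}_+\times\mathbf{R}$. Let $b:\mathbf{R}\to[0,\infty)$ be nonnegative, locally Lipschitz and nondecreasing on $(0,\infty)$, and let $u_0:\mathbf{R}\to[0,\infty)$ be nonnegative and continuous. Suppose $b$ satisfies the Osgood condition: there exists $a>0$ with $\int_a^\infty \frac{1}{b(s)}\,\mathrm{d}s<\infty$ (convention $1/0=\infty$). Then, almost surely, there is no global random field solution to $$\frac{\partial u(t,x)}{\partial t}=\Delta u(t,x)+b(u(t,x))+\sigma\dot W(t,x),\quad x\in\mathbf{R},\ t>0,\qquad u(0,x)=u_0(x).$$
   Context: Let $G(t,x,y)$ denote the heat kernel associated with the Laplacian $\Delta$ on the whole line $\mathbf{R}$. A global random field solution is a jointly measurable, adapted space-time process $u=\{u(t,x)\}_{(t,x)\in\mathbf{R}_+\times\mathbf{R}}$ satisfying, for all $t>0$ and $x\in\mathbf{R}$, $$u(t,x)=\int_{\mathbf{R}}G(t,x,y)u_0(y)\,\mathrm{d}y+\int_0^t\int_{\mathbf{R}}G(t-s,x,y)b(u(s,y))\,\mathrm{d}y\,\mathrm{d}s+\sigma\int_0^t\int_{\mathbf{R}}G(t-s,x,y)W(\mathrm{d}y\,\mathrm{d}s),$$ where the last integral is the Walsh stochastic integral with respect to the white noise. *)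

theory Defs
  imports "HOL-Probability.Probability"
begin

text \<open>Heat kernel of the Laplacian (not one half of it) on the real line:
  G(t,x,y) = (4 pi t)^(-1/2) exp(-(x-y)^2/(4t)).\<close>
definition heat_kernel :: "real \<Rightarrow> real \<Rightarrow> real \<Rightarrow> real" where
  "heat_kernel t x y = exp (- ((x - y)\<^sup>2) / (4 * t)) / sqrt (4 * pi * t)"

text \<open>Space-time points are pairs (s,y): s = time, y = space.
  Square-integrable deterministic integrands on R_+ x R.\<close>
definition sq_int_RpR :: "(real \<times> real \<Rightarrow> real) \<Rightarrow> bool" where
  "sq_int_RpR f \<longleftrightarrow> f \<in> borel_measurable borel \<and>
     set_integrable lborel {p. 0 \<le> fst p} (\<lambda>p. (f p)\<^sup>2)"

definition L2_RpR_norm2 :: "(real \<times> real \<Rightarrow> real) \<Rightarrow> real" where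
  "L2_RpR_norm2 f = (LINT p:{p. 0 \<le> fst p}|lborel. (f p)\<^sup>2)"

text \<open>Wiener integral with respect to a space-time white noise on R_+ x R
  (isonormal Gaussian process on L^2(R_+ x R)): W f is the integral of the
  deterministic integrand f against the white noise. It is centred Gaussian with
  variance the squared L^2 norm, and linear (almost surely).\<close>
definition white_noise :: "'w measure \<Rightarrow> ((real \<times> real \<Rightarrow> real) \<Rightarrow> 'w \<Rightarrow> real) \<Rightarrow> bool" where
  "white_noise M W \<longleftrightarrow> prob_space M \<and>
     (\<forall>f. sq_int_RpR f \<longrightarrow>
        W f \<in> borel_measurable M \<and>
        (L2_RpR_norm2 f > 0 \<longrightarrow>
           distributed M lborel (W f) (\<lambda>z. ennreal (normal_density 0 (sqrt (L2_RpR_norm2 f)) z))) \<and>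
        (L2_RpR_norm2 f = 0 \<longrightarrow> (AE \<omega> in M. W f \<omega> = 0))) \<and>
     (\<forall>f g a c. sq_int_RpR f \<longrightarrow> sq_int_RpR g \<longrightarrow>
        (AE \<omega> in M. W (\<lambda>p. a * f p + c * g p) \<omega> = a * W f \<omega> + c * W g \<omega>))"

definition noise_future :: "'w measure \<Rightarrow> ((real \<times> real \<Rightarrow> real) \<Rightarrow> 'w \<Rightarrow> real) \<Rightarrow> real \<Rightarrow> 'w set set" where
  "noise_future M W t = sigma_sets (space M)
     (\<Union>f\<in>{f. sq_int_RpR f \<and> (\<forall>p. fst p \<le> t \<longrightarrow> f p = 0)}.
        {W f -` A \<inter> space M | A. A \<in> sets borel})"

definition noise_filtration :: "'w measure \<Rightarrow> ((real \<times> real \<Rightarrow> real) \<Rightarrow> 'w \<Rightarrow> real) \<Rightarrow> (real \<Rightarrow> 'w set set) \<Rightarrow> bool" where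
  "noise_filtration M W F \<longleftrightarrow>
     (\<forall>t. sigma_algebra (space M) (F t) \<and> F t \<subseteq> sets M) \<and>
     (\<forall>s t. s \<le> t \<longrightarrow> F s \<subseteq> F t) \<and>
     (\<forall>t\<ge>0. \<forall>f. sq_int_RpR f \<longrightarrow> (\<forall>p. t < fst p \<longrightarrow> f p = 0) \<longrightarrow>
         W f \<in> borel_measurable (sigma (space M) (F t))) \<and>
     (\<forall>t\<ge>0. prob_space.indep_set M (F t) (noise_future M W t))"

definition stoch_kernel :: "real \<Rightarrow> real \<Rightarrow> real \<times> real \<Rightarrow> real" where
  "stoch_kernel t x p = (if 0 \<le> fst p \<and> fst p < t then heat_kernel (t - fst p) x (snd p) else 0)"

definition stoch_conv_version ::
  "'w measure \<Rightarrow> ((real \<times> real \<Rightarrow> real) \<Rightarrow> 'w \<Rightarrow> real) \<Rightarrow> (real \<Rightarrow> real \<Rightarrow> 'w \<Rightarrow> real) \<Rightarrow> bool" where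
  "stoch_conv_version M W Z \<longleftrightarrow>
     (\<lambda>(p, \<omega>). Z (fst p) (snd p) \<omega>) \<in> borel_measurable ((borel :: (real \<times> real) measure) \<Otimes>\<^sub>M M) \<and>
     (\<forall>t>0. \<forall>x. AE \<omega> in M. Z t x \<omega> = W (stoch_kernel t x) \<omega>)"

definition jm_adapted :: "'w measure \<Rightarrow> (real \<Rightarrow> 'w set set) \<Rightarrow> (real \<Rightarrow> real \<Rightarrow> 'w \<Rightarrow> real) \<Rightarrow> bool" where
  "jm_adapted M F u \<longleftrightarrow>
     (\<lambda>(p, \<omega>). u (fst p) (snd p) \<omega>) \<in> borel_measurable ((borel :: (real \<times> real) measure) \<Otimes>\<^sub>M M) \<and>
     (\<forall>t\<ge>0. \<forall>x. u t x \<in> borel_measurable (sigma (space M) (F t)))"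

definition mild_solution_at ::
  "(real \<Rightarrow> real) \<Rightarrow> (real \<Rightarrow> real) \<Rightarrow> real \<Rightarrow> (real \<Rightarrow> real \<Rightarrow> 'w \<Rightarrow> real) \<Rightarrow>
   (real \<Rightarrow> real \<Rightarrow> 'w \<Rightarrow> real) \<Rightarrow> 'w \<Rightarrow> bool" where
  "mild_solution_at b u0 \<sigma> Z u \<omega> \<longleftrightarrow>
     (\<forall>t>0. \<forall>x.
        integrable lborel (\<lambda>y. heat_kernel t x y * u0 y) \<and>
        set_integrable lborel ({0<..<t} \<times> UNIV)
          (\<lambda>p. heat_kernel (t - fst p) x (snd p) * b (u (fst p) (snd p) \<omega>)) \<and>
        u t x \<omega> = (LINT y|lborel. heat_kernel t x y * u0 y)
                  + (LINT p:({0<..<t} \<times> UNIV)|lborel. heat_kernel (t - fst p) x (snd p) * b (u (fst p) (snd p) \<omega>))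
                  + \<sigma> * Z t x \<omega>)"

definition osgood :: "(real \<Rightarrow> real) \<Rightarrow> bool" where
  "osgood b \<longleftrightarrow> (\<exists>a>0. (\<integral>\<^sup>+ s. indicator {a..} s *
       (if b s = 0 then \<infinity> else ennreal (1 / b s)) \<partial>lborel) < \<infinity>)"

definition locally_lipschitz :: "(real \<Rightarrow> real) \<Rightarrow> bool" where
  "locally_lipschitz b \<longleftrightarrow> (\<forall>r. \<exists>L. L-lipschitz_on {-r..r} b)"

end

theory Submission
  imports Defs "HOL-Real_Asymp.Real_Asymp"
begin

text \<open>
  The Gaussian field \<open>Z\<close> is spatially stationary with decaying correlations, so its maximum over \<open>K\<close>
  far apart points \<open>(1, \<xi> k)\<close> is at least of order \<open>sqrt (ln K)\<close>. By chaining, the oscillation of \<open>Z\<close>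
  over the \<open>K\<close> boxes of a fixed small side \<open>\<delta>\<close> at these points is at most a small multiple of
  \<open>sqrt (ln K)\<close>. Hence almost surely \<open>Z\<close> exceeds any given level almost everywhere on one of these boxes,
  with \<open>\<delta>\<close> independent of the level. On such a box with \<open>\<sigma> * Z \<ge> N\<close>, monotonicity of \<open>b\<close> and the lower
  bound \<open>c\<close> for the heat mass kept in an interval show that a solution, once above \<open>N + j\<close>, is above
  \<open>N + j + 1\<close> after a further time \<open>1 / (c * b (N + j))\<close>. These times sum to at most
  \<open>1 / c\<close> times the tail of the Osgood integral, which is less than \<open>\<delta>\<close> for large \<open>N\<close>, so the solution is
  infinite on a set of positive measure.
\<close>

section \<open>Covariance of the heat kernel\<close>

lemma heat_kernel_eq_normal_density:
  assumes "0 < t"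
  shows "heat_kernel t x y = normal_density x (sqrt (2 * t)) y"
  using assms by (simp add: heat_kernel_def normal_density_def power2_commute[of x y])

lemma heat_kernel_nonneg: "0 < t \<Longrightarrow> 0 \<le> heat_kernel t x y"
  by (simp add: heat_kernel_def)

lemma heat_kernel_measurable [measurable]:
  assumes [measurable]: "f \<in> borel_measurable M" "g \<in> borel_measurable M" "h \<in> borel_measurable M"
  shows "(\<lambda>z. heat_kernel (f z) (g z) (h z)) \<in> borel_measurable M"
  unfolding heat_kernel_def by measurable

lemma stoch_kernel_measurable [measurable]: "stoch_kernel t x \<in> borel_measurable borel"
proof -
  have "stoch_kernel t x \<in> borel_measurable (borel \<Otimes>\<^sub>M borel)"
    unfolding stoch_kernel_def by measurable
  then show ?thesis
    by (simp add: borel_prod)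
qed

lemma stoch_kernel_nonneg: "0 \<le> stoch_kernel t x p"
  by (simp add: stoch_kernel_def heat_kernel_nonneg)

text \<open>The substitution \<open>w = z - y\<close> turns the integral into the convolution of two
  centred Gaussian densities at \<open>x - y\<close>, and the variances \<open>2 * a\<close> and
  \<open>2 * c\<close> add.\<close>

lemma heat_kernel_semigroup:
  assumes "0 < a" "0 < c"
  shows "(\<integral>\<^sup>+ z. ennreal (heat_kernel a x z * heat_kernel c y z) \<partial>lborel) = ennreal (heat_kernel (a + c) x y)"
proof -
  let ?f = "\<lambda>w. ennreal (normal_density 0 (sqrt (2 * a)) ((x - y) - w) * normal_density 0 (sqrt (2 * c)) w)"
  have "(\<integral>\<^sup>+ w. ?f w \<partial>lborel) = ennreal \<bar>1\<bar> * (\<integral>\<^sup>+ z. ?f (- y + 1 * z) \<partial>lborel)"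
    by (rule nn_integral_real_affine) simp_all
  also have "\<dots> = (\<integral>\<^sup>+ z. ennreal (heat_kernel a x z * heat_kernel c y z) \<partial>lborel)"
    using assms
    by (auto simp: heat_kernel_eq_normal_density normal_density_def algebra_simps power2_eq_square intro!: nn_integral_cong)
  finally have "(\<integral>\<^sup>+ z. ennreal (heat_kernel a x z * heat_kernel c y z) \<partial>lborel) = (\<integral>\<^sup>+ w. ?f w \<partial>lborel)" ..
  also have "\<dots> = ennreal (normal_density 0 (sqrt ((sqrt (2 * a))\<^sup>2 + (sqrt (2 * c))\<^sup>2)) (x - y))"
    using fun_cong[OF conv_normal_density_zero_mean[of "sqrt (2 * a)" "sqrt (2 * c)"], of "x - y"] assms by simp
  also have "\<dots> = ennreal (heat_kernel (a + c) x y)"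
    using assms by (simp add: heat_kernel_eq_normal_density normal_density_def algebra_simps power2_eq_square)
  finally show ?thesis .
qed

section \<open>Time integrals and bounds for the covariance\<close>

text \<open>For \<open>2 * s = c\<close> and \<open>a < 1\<close> the integrand is singular at
  \<open>s\<close>, so the antiderivative is differentiated in the interior only and the endpoint is
  removed as a null set. It is applied with \<open>a\<close> equal to \<open>1/2\<close> and
  \<open>1/4\<close>; the exponents below are left in the form \<open>1/2 - 1\<close> to
  match.\<close>

lemma has_bochner_integral_powr_linear:
  fixes a c s :: real
  assumes "0 < a" "0 \<le> s" "2 * s \<le> c"
  shows "has_bochner_integral lborel (\<lambda>r. indicator {0..<s} r * (c - 2 * r) powr (a - 1))
           ((c powr a - (c - 2 * s) powr a) / (2 * a))"
proof (rule has_bochner_integral_nn_integral)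
  let ?F = "\<lambda>r. - ((c - 2 * r) powr a) / (2 * a)"
  have "((\<lambda>r. (c - 2 * r) powr (a - 1)) has_integral ?F s - ?F 0) {0..s}"
  proof (rule fundamental_theorem_of_calculus_interior)
    show "continuous_on {0..s} ?F"
      using assms by (intro continuous_intros continuous_on_powr') auto
    fix r assume "r \<in> {0<..<s}"
    then have "0 < c - 2 * r" using assms by auto
    then show "(?F has_vector_derivative (c - 2 * r) powr (a - 1)) (at r)"
      unfolding has_real_derivative_iff_has_vector_derivative[symmetric]
      using assms by (auto intro!: derivative_eq_intros simp: field_simps powr_diff)
  qed (use assms in auto)
  then have "(\<integral>\<^sup>+ r. ennreal ((c - 2 * r) powr (a - 1)) * indicator {0..s} r \<partial>lborel) = ennreal (?F s - ?F 0)"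
    by (intro nn_integral_has_integral_lebesgue') auto
  moreover have "?F s - ?F 0 = (c powr a - (c - 2 * s) powr a) / (2 * a)"
    using assms by (simp add: field_simps)
  moreover have "(\<integral>\<^sup>+ r. ennreal ((c - 2 * r) powr (a - 1)) * indicator {0..s} r \<partial>lborel)
     = (\<integral>\<^sup>+ r. ennreal (indicator {0..<s} r * (c - 2 * r) powr (a - 1)) \<partial>lborel)"
    using AE_lborel_singleton[of s]
    by (intro nn_integral_cong_AE) (auto elim!: eventually_mono simp: indicator_def)
  ultimately show "(\<integral>\<^sup>+ r. ennreal (indicator {0..<s} r * (c - 2 * r) powr (a - 1)) \<partial>lborel)
     = ennreal ((c powr a - (c - 2 * s) powr a) / (2 * a))" by simp
  show "0 \<le> (c powr a - (c - 2 * s) powr a) / (2 * a)"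
    using assms by (auto intro!: divide_nonneg_nonneg powr_mono2)
qed (auto simp: indicator_def)

text \<open>For \<open>0 < s\<close> and \<open>s \<le> t\<close> this is the covariance of
  \<open>Z t x\<close> and \<open>Z s y\<close>, with the space integral already carried out by the
  semigroup property.\<close>

definition heat_cov :: "real \<Rightarrow> real \<Rightarrow> real \<Rightarrow> real \<Rightarrow> real" where
  "heat_cov t x s y = (LINT r|lborel. indicator {0..<s} r * heat_kernel (t + s - 2 * r) x y)"

lemma heat_kernel_le_powr:
  assumes "0 < v"
  shows "heat_kernel v x y \<le> v powr (1/2 - 1)"
proof -
  have "1 * sqrt v \<le> sqrt (4 * pi) * sqrt v"
    using pi_gt3 assms by (intro mult_right_mono) auto
  then have "1 / sqrt (4 * pi * v) \<le> 1 / sqrt v"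
    using assms by (intro divide_left_mono) (auto simp: real_sqrt_mult)
  moreover have "heat_kernel v x y \<le> 1 / sqrt (4 * pi * v)"
    unfolding heat_kernel_def using assms by (intro divide_right_mono) auto
  moreover have "v powr (1/2 - 1) = 1 / sqrt v"
    using assms by (simp add: powr_half_sqrt[symmetric] powr_minus_divide)
  ultimately show ?thesis by linarith
qed

lemma heat_cov_integrable:
  assumes "0 < s" "s \<le> t"
  shows "integrable lborel (\<lambda>r. indicator {0..<s} r * heat_kernel (t + s - 2 * r) x y)"
proof (rule Bochner_Integration.integrable_bound)
  show "integrable lborel (\<lambda>r. indicator {0..<s} r * (t + s - 2 * r) powr (1/2 - 1))"
    using has_bochner_integral_powr_linear[of "1/2" s "t + s"] assms by (auto simp: has_bochner_integral_iff)
  show "AE r in lborel. norm (indicator {0..<s} r * heat_kernel (t + s - 2 * r) x y)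
          \<le> norm (indicator {0..<s} r * (t + s - 2 * r) powr (1/2 - 1))"
    using assms heat_kernel_le_powr[of "t + s - 2 * r" x y for r]
    by (auto simp: indicator_def heat_kernel_nonneg)
qed simp

lemma heat_cov_nonneg: "s \<le> t \<Longrightarrow> 0 \<le> heat_cov t x s y"
  unfolding heat_cov_def by (auto simp: indicator_def heat_kernel_nonneg intro!: Bochner_Integration.integral_nonneg)

text \<open>By Tonelli the space integral comes first. The semigroup property adds the elapsed times
  \<open>t - r\<close> and \<open>s - r\<close>, and the product of the kernels vanishes for
  \<open>r\<close> outside \<open>{0..<s}\<close>.\<close>

lemma stoch_kernel_inner:
  assumes "0 < s" "s \<le> t"
  shows "has_bochner_integral lborel (\<lambda>p. stoch_kernel t x p * stoch_kernel s y p) (heat_cov t x s y)"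
proof (rule has_bochner_integral_nn_integral)
  have "(\<integral>\<^sup>+ p. ennreal (stoch_kernel t x p * stoch_kernel s y p) \<partial>lborel)
      = (\<integral>\<^sup>+ p. ennreal (stoch_kernel t x p * stoch_kernel s y p) \<partial>(lborel \<Otimes>\<^sub>M lborel))"
    by (simp add: lborel_prod)
  also have "\<dots> = (\<integral>\<^sup>+ r. \<integral>\<^sup>+ z. ennreal (stoch_kernel t x (r, z) * stoch_kernel s y (r, z)) \<partial>lborel \<partial>lborel)"
    by (intro lborel.nn_integral_fst[symmetric]) (simp add: lborel_prod)
  also have "\<dots> = (\<integral>\<^sup>+ r. ennreal (indicator {0..<s} r * heat_kernel (t + s - 2 * r) x y) \<partial>lborel)"
  proof (intro nn_integral_cong)
    fix r :: real
    show "(\<integral>\<^sup>+ z. ennreal (stoch_kernel t x (r, z) * stoch_kernel s y (r, z)) \<partial>lborel)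
        = ennreal (indicator {0..<s} r * heat_kernel (t + s - 2 * r) x y)"
      using heat_kernel_semigroup[of "t - r" "s - r" x y] assms
      by (cases "0 \<le> r \<and> r < s") (auto simp: stoch_kernel_def algebra_simps)
  qed
  also have "\<dots> = ennreal (heat_cov t x s y)"
    unfolding heat_cov_def using assms
    by (intro nn_integral_eq_integral heat_cov_integrable) (auto simp: indicator_def heat_kernel_nonneg)
  finally show "(\<integral>\<^sup>+ p. ennreal (stoch_kernel t x p * stoch_kernel s y p) \<partial>lborel) = ennreal (heat_cov t x s y)" .
qed (use assms in \<open>auto simp: heat_cov_nonneg stoch_kernel_nonneg\<close>)

text \<open>At coinciding points the exponential factor of the kernel is 1. In particular the
  variance of the field does not depend on the position \<open>x\<close>.\<close>

lemma heat_cov_diag: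
  assumes "0 < t"
  shows "heat_cov t x t x = sqrt (2 * t) / sqrt (4 * pi)"
proof -
  have "heat_cov t x t x = (LINT r|lborel. (indicator {0..<t} r * (2 * t - 2 * r) powr (1/2 - 1)) / sqrt (4 * pi))"
    unfolding heat_cov_def
    by (intro Bochner_Integration.integral_cong refl)
       (auto simp: heat_kernel_def indicator_def powr_minus_divide powr_half_sqrt[symmetric] powr_mult)
  also have "\<dots> = sqrt (2 * t) / sqrt (4 * pi)"
    using has_bochner_integral_powr_linear[of "1/2" t "2 * t"] assms
    by (simp add: has_bochner_integral_iff powr_half_sqrt)
  finally show ?thesis .
qed

text \<open>All elapsed times \<open>2 * t - 2 * r\<close> are at most \<open>2 * t\<close>, so the
  Gaussian factor is at most its value at \<open>2 * t\<close>, uniformly in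
  \<open>r\<close>.\<close>

lemma heat_cov_far:
  assumes "0 < t"
  shows "heat_cov t x t y \<le> exp (- ((x - y)\<^sup>2) / (8 * t)) * heat_cov t x t x"
proof -
  have "heat_kernel (t + t - 2 * r) x y \<le> exp (- ((x - y)\<^sup>2) / (8 * t)) * heat_kernel (t + t - 2 * r) x x"
    if "0 \<le> r" "r < t" for r
  proof -
    have "(x - y)\<^sup>2 / (8 * t) \<le> (x - y)\<^sup>2 / (4 * (t + t - 2 * r))"
      using that by (intro divide_left_mono) auto
    then show ?thesis
      using that by (auto simp: heat_kernel_def intro!: divide_right_mono)
  qed
  then show ?thesis
    unfolding heat_cov_def integral_mult_right_zero[symmetric] using assms
    by (intro integral_mono heat_cov_integrable integrable_mult_right) (auto simp: indicator_def)
qed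

text \<open>Interpolates between the bounds \<open>u\<close> for small \<open>u\<close> and 1 for
  large \<open>u\<close>.\<close>

lemma one_minus_exp_le_powr:
  fixes u :: real
  assumes "0 \<le> u"
  shows "1 - exp (- u) \<le> u powr (1/4)"
proof (cases "u \<le> 1")
  case True
  have "1 - exp (- u) \<le> u" using exp_ge_add_one_self[of "- u"] by linarith
  also have "u \<le> u powr (1/4)"
  proof (cases "u = 0")
    case False
    then show ?thesis using powr_mono'[of "1/4" 1 u] True assms by simp
  qed simp
  finally show ?thesis .
next
  case False
  then have "1 \<le> u powr (1/4)" by (intro ge_one_powr_ge_zero) auto
  then show ?thesis using exp_gt_zero[of "-u"] by linarith
qed

text \<open>The loss from the Gaussian factor is bounded by the power \<open>1/4\<close> of
  \<open>(x - y)\<^sup>2 / v\<close>. This power leaves \<open>v powr (-3/4)\<close>, which is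
  integrable at 0; the power \<open>1/2\<close> would leave \<open>1 / v\<close>, which is
  not.\<close>

lemma heat_kernel_ge_powr:
  assumes "0 < v"
  shows "v powr (1/2 - 1) / sqrt (4 * pi) - sqrt \<bar>x - y\<bar> * v powr (1/4 - 1) \<le> heat_kernel v x y"
proof -
  let ?d = "\<bar>x - y\<bar>"
  have G: "heat_kernel v x y = exp (- (?d\<^sup>2 / (4 * v))) * (v powr (1/2 - 1) / sqrt (4 * pi))"
    using assms by (simp add: heat_kernel_def powr_minus_divide powr_half_sqrt[symmetric] powr_mult)
  have "(?d\<^sup>2 / (4 * v)) powr (1/4) \<le> (?d\<^sup>2 / v) powr (1/4)"
    using assms by (intro powr_mono2) (auto intro!: divide_left_mono)
  also have "\<dots> = sqrt ?d * v powr (-1/4)"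
  proof (cases "?d = 0")
    case False
    then have "?d\<^sup>2 = ?d powr 2" by simp
    then have "(?d\<^sup>2) powr (1/4) = sqrt ?d" using False by (simp only: powr_powr) (simp add: powr_half_sqrt)
    then show ?thesis using assms by (simp add: powr_divide powr_minus_divide)
  qed simp
  finally have "1 - exp (- (?d\<^sup>2 / (4 * v))) \<le> sqrt ?d * v powr (-1/4)"
    using one_minus_exp_le_powr[of "?d\<^sup>2 / (4 * v)"] assms by auto
  then have "(1 - exp (- (?d\<^sup>2 / (4 * v)))) * (v powr (1/2 - 1) / sqrt (4 * pi))
      \<le> (sqrt ?d * v powr (-1/4)) * (v powr (1/2 - 1) / sqrt (4 * pi))"
    using assms by (intro mult_right_mono) auto
  also have "\<dots> \<le> (sqrt ?d * v powr (-1/4)) * (v powr (1/2 - 1))"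
  proof -
    have "1 \<le> sqrt (4 * pi)" using pi_gt3 by simp
    then have "v powr (1/2 - 1) / sqrt (4 * pi) \<le> v powr (1/2 - 1) / 1"
      by (intro divide_left_mono) auto
    then show ?thesis using assms by (intro mult_left_mono) auto
  qed
  also have "\<dots> = sqrt ?d * v powr (1/4 - 1)"
    by (simp add: powr_add[symmetric] mult.assoc)
  finally show ?thesis unfolding G by (simp add: algebra_simps)
qed

text \<open>The pointwise bound \<open>heat_kernel_ge_powr\<close> is integrated in time, and the
  favourable term with \<open>(t - s) powr (1/4)\<close> is dropped.\<close>

lemma heat_cov_ge:
  assumes "0 < s" "s \<le> t"
  shows "(sqrt (t + s) - sqrt (t - s)) / sqrt (4 * pi) - 2 * sqrt \<bar>x - y\<bar> * (t + s) powr (1/4)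
     \<le> heat_cov t x s y"
proof -
  let ?A = "\<lambda>r. indicator {0..<s} r * (t + s - 2 * r) powr (1/2 - 1)"
  let ?B = "\<lambda>r. indicator {0..<s} r * (t + s - 2 * r) powr (1/4 - 1)"
  have A: "has_bochner_integral lborel ?A (sqrt (t + s) - sqrt (t - s))"
    using has_bochner_integral_powr_linear[of "1/2" s "t + s"] assms by (simp add: powr_half_sqrt)
  have B: "has_bochner_integral lborel ?B (2 * ((t + s) powr (1/4) - (t - s) powr (1/4)))"
    using has_bochner_integral_powr_linear[of "1/4" s "t + s"] assms by (simp add: mult.commute)
  have AB: "has_bochner_integral lborel (\<lambda>r. ?A r / sqrt (4 * pi) - sqrt \<bar>x - y\<bar> * ?B r)
      ((sqrt (t + s) - sqrt (t - s)) / sqrt (4 * pi)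
        - sqrt \<bar>x - y\<bar> * (2 * ((t + s) powr (1/4) - (t - s) powr (1/4))))"
    using A B by (intro has_bochner_integral_diff has_bochner_integral_mult_right has_bochner_integral_divide_zero) auto
  have "(LINT r|lborel. ?A r / sqrt (4 * pi) - sqrt \<bar>x - y\<bar> * ?B r) \<le> heat_cov t x s y"
    unfolding heat_cov_def
  proof (intro integral_mono heat_cov_integrable assms)
    show "integrable lborel (\<lambda>r. ?A r / sqrt (4 * pi) - sqrt \<bar>x - y\<bar> * ?B r)"
      using AB by (simp add: has_bochner_integral_iff)
    fix r :: real
    show "?A r / sqrt (4 * pi) - sqrt \<bar>x - y\<bar> * ?B r \<le> indicator {0..<s} r * heat_kernel (t + s - 2 * r) x y"
      using heat_kernel_ge_powr[of "t + s - 2 * r" x y] assms by (auto simp: indicator_def)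
  qed
  moreover have "0 \<le> sqrt \<bar>x - y\<bar> * (t - s) powr (1/4)" by simp
  ultimately show ?thesis
    unfolding has_bochner_integral_integral_eq[OF AB] right_diff_distrib by linarith
qed

section \<open>Variances of increments\<close>

lemma sq_int_lincomb_stoch_kernel:
  assumes "0 < s" "s \<le> t"
  shows "sq_int_RpR (\<lambda>p. a * stoch_kernel t x p + c * stoch_kernel s y p)"
    and "L2_RpR_norm2 (\<lambda>p. a * stoch_kernel t x p + c * stoch_kernel s y p)
       = a\<^sup>2 * heat_cov t x t x + c\<^sup>2 * heat_cov s y s y + 2 * a * c * heat_cov t x s y"
proof -
  let ?f = "\<lambda>p. a * stoch_kernel t x p + c * stoch_kernel s y p"
  have sq: "(?f p)\<^sup>2 = a\<^sup>2 * (stoch_kernel t x p * stoch_kernel t x p)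
       + c\<^sup>2 * (stoch_kernel s y p * stoch_kernel s y p) + 2 * a * c * (stoch_kernel t x p * stoch_kernel s y p)" for p
    by (simp add: power2_eq_square algebra_simps)
  \<comment> \<open>The kernels vanish at negative times, so the restriction to the half-plane
    changes nothing.\<close>
  have ind: "indicator {p. 0 \<le> fst p} p *\<^sub>R (?f p)\<^sup>2 = (?f p)\<^sup>2" for p :: "real \<times> real"
    by (simp add: stoch_kernel_def indicator_def)
  have *: "has_bochner_integral lborel (\<lambda>p. (?f p)\<^sup>2)
      (a\<^sup>2 * heat_cov t x t x + c\<^sup>2 * heat_cov s y s y + 2 * a * c * heat_cov t x s y)"
    unfolding sq using assms
    by (intro has_bochner_integral_add has_bochner_integral_mult_right stoch_kernel_inner) auto
  show "sq_int_RpR ?f"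
    using * unfolding sq_int_RpR_def set_integrable_def ind by (auto simp: has_bochner_integral_iff)
  show "L2_RpR_norm2 ?f = a\<^sup>2 * heat_cov t x t x + c\<^sup>2 * heat_cov s y s y + 2 * a * c * heat_cov t x s y"
    using * unfolding L2_RpR_norm2_def set_lebesgue_integral_def ind by (auto simp: has_bochner_integral_iff)
qed

text \<open>The left-hand side is the variance of \<open>Z t x - Z s y\<close>. The leading terms
  cancel because the square root is concave, which leaves the contributions of the time lag and of
  the distance. The time range gives \<open>(t + s) powr (1/4) \<le> 2\<close>, whence the constant
  8.\<close>

lemma stoch_kernel_increment:
  assumes "1 \<le> s" "s \<le> t" "t \<le> 2"
  shows "heat_cov t x t x + heat_cov s y s y - 2 * heat_cov t x s y \<le> sqrt (t - s) + 8 * sqrt \<bar>x - y\<bar>"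
proof -
  have pos: "0 < s" and post: "0 < t" using assms by auto
  have "(sqrt (2 * t) + sqrt (2 * s))\<^sup>2 \<le> 2 * ((sqrt (2 * t))\<^sup>2 + (sqrt (2 * s))\<^sup>2)"
    using sum_squares_bound[of "sqrt (2 * t)" "sqrt (2 * s)"] by (simp add: power2_sum)
  also have "\<dots> = (2 * sqrt (t + s))\<^sup>2"
    using assms by (simp add: power_mult_distrib)
  finally have conc: "sqrt (2 * t) + sqrt (2 * s) \<le> 2 * sqrt (t + s)"
    by (rule power2_le_imp_le) (use assms in auto)
  have pi2: "2 \<le> sqrt (4 * pi)" using pi_gt3 by (intro real_le_rsqrt) auto
  have "(t + s) powr (1/4) \<le> 4 powr (1/4)" using assms by (intro powr_mono2) auto
  also have "4 powr (1/4) \<le> (4::real) powr (1/2)" by (intro powr_mono) auto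
  also have "\<dots> = 2" by (simp add: powr_half_sqrt)
  finally have q: "(t + s) powr (1/4) \<le> 2" .
  have "heat_cov t x t x + heat_cov s y s y - 2 * heat_cov t x s y
     \<le> sqrt (2 * t) / sqrt (4 * pi) + sqrt (2 * s) / sqrt (4 * pi)
        - 2 * ((sqrt (t + s) - sqrt (t - s)) / sqrt (4 * pi) - 2 * sqrt \<bar>x - y\<bar> * (t + s) powr (1/4))"
    using heat_cov_ge[OF pos \<open>s \<le> t\<close>, of x y] heat_cov_diag[OF post, of x] heat_cov_diag[OF pos, of y]
    by (intro diff_mono add_mono mult_left_mono) auto
  also have "\<dots> = (sqrt (2 * t) + sqrt (2 * s) - 2 * sqrt (t + s)) / sqrt (4 * pi)
       + sqrt (t - s) * (2 / sqrt (4 * pi)) + sqrt \<bar>x - y\<bar> * (4 * (t + s) powr (1/4))"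
    by (simp add: field_simps)
  also have "\<dots> \<le> 0 + sqrt (t - s) * 1 + sqrt \<bar>x - y\<bar> * 8"
    using conc pi2 q assms
    by (intro add_mono mult_left_mono divide_nonpos_nonneg) (auto simp: divide_le_eq)
  finally show ?thesis by simp
qed

section \<open>Gaussian tails and maxima\<close>

text \<open>Completing the square moves the mean of the density from 0 to
  \<open>s\<^sup>2\<close>.\<close>

lemma normal_density_exp_moment:
  assumes "0 < s"
  shows "has_bochner_integral lborel (\<lambda>z. normal_density 0 s z * exp z) (exp (s\<^sup>2 / 2))"
proof -
  have "normal_density 0 s z * exp z = exp (s\<^sup>2 / 2) * normal_density (s\<^sup>2) s z" for z
  proof -
    have "- (z - 0)\<^sup>2 / (2 * s\<^sup>2) + z = s\<^sup>2 / 2 + - (z - s\<^sup>2)\<^sup>2 / (2 * s\<^sup>2)"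
      using assms by (simp add: power2_eq_square field_simps)
    then have "exp (- (z - 0)\<^sup>2 / (2 * s\<^sup>2)) * exp z = exp (s\<^sup>2 / 2) * exp (- (z - s\<^sup>2)\<^sup>2 / (2 * s\<^sup>2))"
      by (simp only: exp_add[symmetric])
    then show ?thesis by (simp add: normal_density_def)
  qed
  then show ?thesis
    using assms by (simp add: has_bochner_integral_iff)
qed

section \<open>Exponential moments and increments of the stochastic convolution\<close>

locale stochastic_convolution =
  fixes M :: "'w measure"
    and W :: "(real \<times> real \<Rightarrow> real) \<Rightarrow> 'w \<Rightarrow> real"
    and Z :: "real \<Rightarrow> real \<Rightarrow> 'w \<Rightarrow> real"
  assumes noise: "white_noise M W"
    and conv: "stoch_conv_version M W Z"

sublocale stochastic_convolution \<subseteq> prob_space M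
  using noise by (simp add: white_noise_def)

context stochastic_convolution
begin

lemma joint_measurable [measurable]:
  "(\<lambda>(p, \<omega>). Z (fst p) (snd p) \<omega>) \<in> borel_measurable ((borel :: (real \<times> real) measure) \<Otimes>\<^sub>M M)"
  using conv by (simp add: stoch_conv_version_def)

lemma Z_measurable [measurable]: "Z t x \<in> borel_measurable M"
proof -
  have "(\<lambda>\<omega>. (\<lambda>(p, \<omega>). Z (fst p) (snd p) \<omega>) ((t, x), \<omega>)) \<in> borel_measurable M"
    by measurable
  then show ?thesis by simp
qed

text \<open>A vanishing norm is a separate case, since the integral is then almost surely 0 and has
  no density.\<close>

lemma Wiener_integral_exp_moment:
  assumes f: "sq_int_RpR f"
  shows "has_bochner_integral M (\<lambda>\<omega>. exp (W f \<omega>)) (exp (L2_RpR_norm2 f / 2))"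
proof -
  have W [measurable]: "W f \<in> borel_measurable M"
    and pos: "L2_RpR_norm2 f > 0 \<Longrightarrow>
       distributed M lborel (W f) (\<lambda>z. ennreal (normal_density 0 (sqrt (L2_RpR_norm2 f)) z))"
    and zero: "L2_RpR_norm2 f = 0 \<Longrightarrow> AE \<omega> in M. W f \<omega> = 0"
    using noise f by (auto simp: white_noise_def)
  have "0 \<le> L2_RpR_norm2 f"
    unfolding L2_RpR_norm2_def set_lebesgue_integral_def by (intro Bochner_Integration.integral_nonneg) auto
  then consider "L2_RpR_norm2 f = 0" | "0 < L2_RpR_norm2 f" by linarith
  then show ?thesis
  proof cases
    case 1
    have "has_bochner_integral M (\<lambda>\<omega>. exp (W f \<omega>)) 1 \<longleftrightarrow> has_bochner_integral M (\<lambda>\<omega>. 1::real) 1"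
      using zero[OF 1] by (intro has_bochner_integral_cong_AE) auto
    moreover have "has_bochner_integral M (\<lambda>\<omega>. 1::real) 1"
      by (simp add: has_bochner_integral_iff prob_space)
    ultimately show ?thesis using 1 by simp
  next
    case 2
    note d = pos[OF 2]
    have "has_bochner_integral lborel (\<lambda>z. normal_density 0 (sqrt (L2_RpR_norm2 f)) z * exp z) (exp (L2_RpR_norm2 f / 2))"
      using normal_density_exp_moment[of "sqrt (L2_RpR_norm2 f)"] 2 by simp
    then show ?thesis
      using distributed_integral[OF d, of exp] distributed_integrable[OF d, of exp]
      by (simp add: has_bochner_integral_iff)
  qed
qed

text \<open>Linearity of \<open>W\<close> turns the combination of two field values into a single
  Wiener integral. These two-point exponential moments carry all the information on the law of
  \<open>Z\<close> that the tail estimates and the second moment method below draw on.\<close>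

lemma exp_moment:
  assumes "0 < s" "s \<le> t"
  shows "has_bochner_integral M (\<lambda>\<omega>. exp (a * Z t x \<omega> + c * Z s y \<omega>))
     (exp ((a\<^sup>2 * heat_cov t x t x + c\<^sup>2 * heat_cov s y s y + 2 * a * c * heat_cov t x s y) / 2))"
proof -
  let ?f = "\<lambda>p. a * stoch_kernel t x p + c * stoch_kernel s y p"
  note f = sq_int_lincomb_stoch_kernel[OF assms, of _ x _ y]
  have s1: "sq_int_RpR (stoch_kernel t x)" and s2: "sq_int_RpR (stoch_kernel s y)"
    using f(1)[of 1 0] f(1)[of 0 1] by auto
  have [measurable]: "W ?f \<in> borel_measurable M"
    using noise f(1)[of a c] unfolding white_noise_def by blast
  have "AE \<omega> in M. W ?f \<omega> = a * W (stoch_kernel t x) \<omega> + c * W (stoch_kernel s y) \<omega>"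
    using noise s1 s2 unfolding white_noise_def by blast
  moreover have "AE \<omega> in M. Z t x \<omega> = W (stoch_kernel t x) \<omega>" "AE \<omega> in M. Z s y \<omega> = W (stoch_kernel s y) \<omega>"
    using conv assms unfolding stoch_conv_version_def by auto
  ultimately have "AE \<omega> in M. exp (a * Z t x \<omega> + c * Z s y \<omega>) = exp (W ?f \<omega>)"
    by eventually_elim simp
  then have "has_bochner_integral M (\<lambda>\<omega>. exp (a * Z t x \<omega> + c * Z s y \<omega>)) (exp (L2_RpR_norm2 ?f / 2))
     \<longleftrightarrow> has_bochner_integral M (\<lambda>\<omega>. exp (W ?f \<omega>)) (exp (L2_RpR_norm2 ?f / 2))"
    by (intro has_bochner_integral_cong_AE) auto
  then show ?thesis
    using Wiener_integral_exp_moment[OF f(1)[of a c]] unfolding f(2) by simp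
qed

text \<open>A Chernoff bound, with \<open>v\<close> dominating the variance of the increment by
  \<open>stoch_kernel_increment\<close>.\<close>

lemma increment_tail_ordered:
  assumes "1 \<le> s" "s \<le> t" "t \<le> 2" "0 < v" "sqrt (t - s) + 8 * sqrt \<bar>x - y\<bar> \<le> v" "0 < r"
  shows "prob {\<omega>\<in>space M. r < \<bar>Z t x \<omega> - Z s y \<omega>\<bar>} \<le> 2 * exp (- (r\<^sup>2 / (2 * v)))"
proof -
  \<comment> \<open>The sign \<open>\<epsilon>\<close> is 1 or -1 and covers both tails at
    once.\<close>
  have one_sided: "prob {\<omega>\<in>space M. \<epsilon> * (Z t x \<omega> - Z s y \<omega>) \<ge> r} \<le> exp (- (r\<^sup>2 / (2 * v)))"
    if "\<epsilon>\<^sup>2 = 1" for \<epsilon> :: real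
  proof -
    let ?V = "heat_cov t x t x + heat_cov s y s y - 2 * heat_cov t x s y"
    \<comment> \<open>This choice minimises the exponent
      \<open>- h * r + h\<^sup>2 * v / 2\<close>.\<close>
    let ?h = "r / v"
    have "has_bochner_integral M (\<lambda>\<omega>. exp ((?h * \<epsilon>) * Z t x \<omega> + (- (?h * \<epsilon>)) * Z s y \<omega>))
      (exp (((?h * \<epsilon>)\<^sup>2 * heat_cov t x t x + (- (?h * \<epsilon>))\<^sup>2 * heat_cov s y s y + 2 * (?h * \<epsilon>) * (- (?h * \<epsilon>)) * heat_cov t x s y) / 2))"
      using assms by (intro exp_moment) auto
    moreover have "(?h * \<epsilon>)\<^sup>2 * heat_cov t x t x + (- (?h * \<epsilon>))\<^sup>2 * heat_cov s y s y + 2 * (?h * \<epsilon>) * (- (?h * \<epsilon>)) * heat_cov t x s y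
        = ?h\<^sup>2 * \<epsilon>\<^sup>2 * ?V"
      unfolding power2_minus power_mult_distrib by (simp add: power2_eq_square algebra_simps add_divide_distrib)
    moreover have "(?h * \<epsilon>) * Z t x \<omega> + (- (?h * \<epsilon>)) * Z s y \<omega> = ?h * (\<epsilon> * (Z t x \<omega> - Z s y \<omega>))" for \<omega>
      by (simp add: algebra_simps)
    ultimately have E: "has_bochner_integral M (\<lambda>\<omega>. exp (?h * (\<epsilon> * (Z t x \<omega> - Z s y \<omega>)))) (exp (?h\<^sup>2 * ?V / 2))"
      using that by simp
    have "prob {\<omega>\<in>space M. \<epsilon> * (Z t x \<omega> - Z s y \<omega>) \<ge> r}
        \<le> exp (- ?h * r) * (\<integral>\<omega>\<in>space M. exp (?h * (\<epsilon> * (Z t x \<omega> - Z s y \<omega>))) \<partial>M)"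
      using E assms by (intro Chernoff_ineq_ge)
        (auto simp: has_bochner_integral_iff set_integrable_def
          intro!: integrable_mult_indicator[where 'b = real, unfolded real_scaleR_def])
    also have "(\<integral>\<omega>\<in>space M. exp (?h * (\<epsilon> * (Z t x \<omega> - Z s y \<omega>))) \<partial>M) = exp (?h\<^sup>2 * ?V / 2)"
      using E by (simp add: set_integral_space has_bochner_integral_iff)
    also have "exp (- ?h * r) * exp (?h\<^sup>2 * ?V / 2) \<le> exp (- ?h * r) * exp (?h\<^sup>2 * v / 2)"
      using stoch_kernel_increment[of s t x y] assms by (auto intro!: mult_left_mono)
    also have "\<dots> = exp (- (r\<^sup>2 / (2 * v)))"
      unfolding exp_add[symmetric] using assms by (simp add: power2_eq_square field_simps)
    finally show ?thesis .
  qed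
  have "prob {\<omega>\<in>space M. r < \<bar>Z t x \<omega> - Z s y \<omega>\<bar>}
      \<le> prob ({\<omega>\<in>space M. 1 * (Z t x \<omega> - Z s y \<omega>) \<ge> r} \<union> {\<omega>\<in>space M. (-1) * (Z t x \<omega> - Z s y \<omega>) \<ge> r})"
    by (intro finite_measure_mono) auto
  also have "\<dots> \<le> prob {\<omega>\<in>space M. 1 * (Z t x \<omega> - Z s y \<omega>) \<ge> r} + prob {\<omega>\<in>space M. (-1) * (Z t x \<omega> - Z s y \<omega>) \<ge> r}"
    by (intro measure_Un_le) auto
  also have "\<dots> \<le> 2 * exp (- (r\<^sup>2 / (2 * v)))"
    using one_sided[of 1] one_sided[of "-1"] by simp
  finally show ?thesis .
qed

lemma increment_tail:
  assumes "t \<in> {1..2}" "s \<in> {1..2}" "0 < v" "sqrt \<bar>t - s\<bar> + 8 * sqrt \<bar>x - y\<bar> \<le> v" "0 < r"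
  shows "prob {\<omega>\<in>space M. r < \<bar>Z t x \<omega> - Z s y \<omega>\<bar>} \<le> 2 * exp (- (r\<^sup>2 / (2 * v)))"
proof (cases "s \<le> t")
  case True
  then show ?thesis using assms by (intro increment_tail_ordered) auto
next
  case False
  then show ?thesis
    using increment_tail_ordered[of t s v y x r] assms by (simp add: abs_minus_commute)
qed

section \<open>Maxima over weakly correlated points\<close>

text \<open>Second moment method for the sum \<open>S\<close> of the exponentials of
  \<open>\<theta>\<close> times the field values. If all values are low, \<open>S\<close> is at most
  half its mean, and Chebyshev applies. In the relative variance the diagonal contributes
  \<open>exp (\<theta>\<^sup>2 * v) / K\<close> and the correlations contribute
  \<open>exp (\<theta>\<^sup>2 * \<eta>) - 1\<close>.\<close>

lemma max_lower_tail:
  fixes K :: nat and \<xi> :: "nat \<Rightarrow> real"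
  defines "v \<equiv> heat_cov 1 0 1 0"
  assumes "0 < \<theta>" "0 < K" "0 \<le> \<eta>"
    and cov: "\<And>j k. j < K \<Longrightarrow> k < K \<Longrightarrow> j \<noteq> k \<Longrightarrow> heat_cov 1 (\<xi> j) 1 (\<xi> k) \<le> \<eta>"
  shows "prob {\<omega>\<in>space M. \<forall>k<K. Z 1 (\<xi> k) \<omega> < \<theta> * v / 2 - ln 2 / \<theta>}
      \<le> 4 * (exp (\<theta>\<^sup>2 * v) / K + exp (\<theta>\<^sup>2 * \<eta>) - 1)"
proof -
  define S where "S \<omega> = (\<Sum>k<K. exp (\<theta> * Z 1 (\<xi> k) \<omega>))" for \<omega>
  define m where "m = exp (\<theta>\<^sup>2 * v / 2)"
  have v: "heat_cov 1 x 1 x = v" for x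
    by (simp add: v_def heat_cov_diag)
  have m2: "m\<^sup>2 = exp (\<theta>\<^sup>2 * v)" and m4: "m ^ 4 = exp (2 * \<theta>\<^sup>2 * v)" and "0 < m"
    by (auto simp: m_def exp_of_nat_mult[symmetric])
  have [measurable]: "S \<in> borel_measurable M" unfolding S_def by measurable
  have "has_bochner_integral M (\<lambda>\<omega>. exp (\<theta> * Z 1 (\<xi> k) \<omega>)) m" for k
    using exp_moment[of 1 1 \<theta> "\<xi> k" 0 0] by (simp add: v m_def)
  then have "has_bochner_integral M S (\<Sum>k<K. m)"
    unfolding S_def[abs_def] by (intro has_bochner_integral_sum)
  then have ES: "integrable M S" "expectation S = K * m"
    by (auto simp: has_bochner_integral_iff)
  have S2: "(S \<omega>)\<^sup>2 = (\<Sum>j<K. \<Sum>k<K. exp (\<theta> * Z 1 (\<xi> j) \<omega> + \<theta> * Z 1 (\<xi> k) \<omega>))" for \<omega>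
    by (simp add: S_def power2_eq_square sum_product exp_add)
  have "has_bochner_integral M (\<lambda>\<omega>. exp (\<theta> * Z 1 (\<xi> j) \<omega> + \<theta> * Z 1 (\<xi> k) \<omega>))
      (m\<^sup>2 * exp (\<theta>\<^sup>2 * heat_cov 1 (\<xi> j) 1 (\<xi> k)))" for j k
    using exp_moment[of 1 1 \<theta> "\<xi> j" \<theta> "\<xi> k"] unfolding m2 exp_add[symmetric]
    by (simp add: v power2_eq_square add_divide_distrib mult.assoc)
  then have "has_bochner_integral M (\<lambda>\<omega>. (S \<omega>)\<^sup>2) (\<Sum>j<K. \<Sum>k<K. m\<^sup>2 * exp (\<theta>\<^sup>2 * heat_cov 1 (\<xi> j) 1 (\<xi> k)))"
    unfolding S2 by (intro has_bochner_integral_sum)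
  then have ES2: "integrable M (\<lambda>\<omega>. (S \<omega>)\<^sup>2)"
     "expectation (\<lambda>\<omega>. (S \<omega>)\<^sup>2) = (\<Sum>j<K. \<Sum>k<K. m\<^sup>2 * exp (\<theta>\<^sup>2 * heat_cov 1 (\<xi> j) 1 (\<xi> k)))"
    by (auto simp: has_bochner_integral_iff)
  \<comment> \<open>The diagonal terms equal \<open>m ^ 4\<close>; giving them the off-diagonal
    bound as well only enlarges the right-hand side and makes the double sum explicit.\<close>
  have "expectation (\<lambda>\<omega>. (S \<omega>)\<^sup>2) \<le> (\<Sum>j<K. \<Sum>k<K. m\<^sup>2 * exp (\<theta>\<^sup>2 * \<eta>) + (if j = k then m ^ 4 else 0))"
    unfolding ES2
  proof (intro sum_mono)
    fix j k assume jk: "j \<in> {..<K}" "k \<in> {..<K}"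
    show "m\<^sup>2 * exp (\<theta>\<^sup>2 * heat_cov 1 (\<xi> j) 1 (\<xi> k)) \<le> m\<^sup>2 * exp (\<theta>\<^sup>2 * \<eta>) + (if j = k then m ^ 4 else 0)"
    proof (cases "j = k")
      case True
      have "m\<^sup>2 * exp (\<theta>\<^sup>2 * v) = m ^ 4" unfolding m2 m4 exp_add[symmetric] by simp
      then show ?thesis using True by (simp add: v)
    next
      case False
      then show ?thesis using cov[of j k] jk by (auto intro!: mult_left_mono)
    qed
  qed
  also have "\<dots> = K\<^sup>2 * m\<^sup>2 * exp (\<theta>\<^sup>2 * \<eta>) + K * m ^ 4"
    by (simp add: sum.distrib power2_eq_square algebra_simps)
  finally have "variance S \<le> K\<^sup>2 * m\<^sup>2 * exp (\<theta>\<^sup>2 * \<eta>) + K * m ^ 4 - (K * m)\<^sup>2"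
    using variance_eq[OF ES(1) ES2(1)] ES by simp
  then have "variance S / (K * m / 2)\<^sup>2 \<le> (K\<^sup>2 * m\<^sup>2 * exp (\<theta>\<^sup>2 * \<eta>) + K * m ^ 4 - (K * m)\<^sup>2) / (K * m / 2)\<^sup>2"
    by (intro divide_right_mono) auto
  also have "\<dots> = 4 * (m\<^sup>2 / K + exp (\<theta>\<^sup>2 * \<eta>) - 1)"
    using \<open>0 < m\<close> \<open>0 < K\<close> by (simp add: field_simps power2_eq_square power4_eq_xxxx)
  finally have var: "variance S / (K * m / 2)\<^sup>2 \<le> 4 * (m\<^sup>2 / K + exp (\<theta>\<^sup>2 * \<eta>) - 1)" .
  have "prob {\<omega>\<in>space M. \<forall>k<K. Z 1 (\<xi> k) \<omega> < \<theta> * v / 2 - ln 2 / \<theta>} \<le> prob {\<omega>\<in>space M. \<bar>S \<omega> - expectation S\<bar> \<ge> K * m / 2}"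
  proof (intro finite_measure_mono subsetI)
    fix \<omega> assume "\<omega> \<in> {\<omega>\<in>space M. \<forall>k<K. Z 1 (\<xi> k) \<omega> < \<theta> * v / 2 - ln 2 / \<theta>}"
    then have w: "\<omega> \<in> space M" "\<And>k. k < K \<Longrightarrow> Z 1 (\<xi> k) \<omega> < \<theta> * v / 2 - ln 2 / \<theta>" by auto
    \<comment> \<open>The term \<open>ln 2 / \<theta>\<close> in the threshold is what brings each
      summand to at most half of its mean \<open>m\<close>.\<close>
    have "exp (\<theta> * Z 1 (\<xi> k) \<omega>) \<le> m / 2" if "k < K" for k
    proof -
      have "\<theta> * Z 1 (\<xi> k) \<omega> \<le> \<theta> * (\<theta> * v / 2 - ln 2 / \<theta>)"
        using w(2)[OF that] \<open>0 < \<theta>\<close> by (intro mult_left_mono) auto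
      also have "\<dots> = \<theta>\<^sup>2 * v / 2 - ln 2" using \<open>0 < \<theta>\<close> by (simp add: field_simps power2_eq_square)
      finally have "exp (\<theta> * Z 1 (\<xi> k) \<omega>) \<le> exp (\<theta>\<^sup>2 * v / 2 - ln 2)" by simp
      then show ?thesis by (simp add: m_def exp_diff)
    qed
    then have "S \<omega> \<le> (\<Sum>k<K. m / 2)" unfolding S_def by (intro sum_mono) auto
    then show "\<omega> \<in> {\<omega>\<in>space M. \<bar>S \<omega> - expectation S\<bar> \<ge> K * m / 2}"
      using w ES abs_ge_minus_self[of "S \<omega> - K * m"] by auto
  qed auto
  also have "\<dots> \<le> variance S / (K * m / 2)\<^sup>2"
    using ES2 \<open>0 < m\<close> \<open>0 < K\<close> by (intro Chebyshev_inequality) auto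
  finally show ?thesis using var unfolding m2 by linarith
qed

end

section \<open>Chaining\<close>

text \<open>The increments allowed at level \<open>k\<close> of the chain are proportional to these
  summands, so their total stays below 4 times the factor.\<close>

lemma sum_Suc_div_power2: "(\<Sum>k<n. (real k + 1) / 2 ^ k) = 4 - 2 * (real n + 2) / 2 ^ n"
proof (induction n)
  case (Suc n)
  then have "(\<Sum>k<Suc n. (real k + 1) / 2 ^ k) = 4 - 2 * (real n + 2) / 2 ^ n + (real n + 1) / 2 ^ n"
    by simp
  also have "\<dots> = 4 - 2 * (real (Suc n) + 2) / 2 ^ Suc n"
    by (simp add: field_simps)
  finally show ?case .
qed simp

text \<open>Division by 16 drops the last base-16 digit: the approximation of \<open>a\<close> at
  level \<open>n\<close> is the parent of the one at level \<open>Suc n\<close>.\<close>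

lemma nat_floor_div_16:
  fixes a :: real
  assumes "0 \<le> a"
  shows "nat \<lfloor>16 ^ Suc n * a\<rfloor> div 16 = nat \<lfloor>16 ^ n * a\<rfloor>"
proof -
  have "\<lfloor>16 ^ Suc n * a / real_of_int 16\<rfloor> = \<lfloor>16 ^ Suc n * a\<rfloor> div 16"
    by (rule floor_divide_real_eq_div) simp
  then show ?thesis
    using assms by (simp add: nat_div_distrib)
qed

lemma grid_parent_dist: "\<bar>real i / 16 ^ Suc n - real (i div 16) / 16 ^ n\<bar> \<le> 1 / 16 ^ n"
proof -
  have "real i = 16 * real (i div 16) + real (i mod 16)"
    by (metis mult_div_mod_eq of_nat_add of_nat_mult of_nat_numeral)
  then have "real i / 16 ^ Suc n - real (i div 16) / 16 ^ n = real (i mod 16) / 16 ^ Suc n"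
    by (simp add: field_simps)
  moreover have "real (i mod 16) \<le> 16"
    using mod_less_divisor[of 16 i] by linarith
  ultimately show ?thesis by (simp add: field_simps)
qed

lemma nat_floor_grid_dist:
  fixes a :: real
  assumes "0 \<le> a"
  shows "\<bar>a - real (nat \<lfloor>16 ^ n * a\<rfloor>) / 16 ^ n\<bar> \<le> 1 / 16 ^ n"
proof -
  have "\<bar>16 ^ n * a - real (nat \<lfloor>16 ^ n * a\<rfloor>)\<bar> \<le> 1"
    using assms by (simp add: of_nat_nat) linarith
  then have "\<bar>16 ^ n * a - real (nat \<lfloor>16 ^ n * a\<rfloor>)\<bar> / 16 ^ n \<le> 1 / 16 ^ n"
    by (intro divide_right_mono) auto
  moreover have "a - real (nat \<lfloor>16 ^ n * a\<rfloor>) / 16 ^ n = (16 ^ n * a - real (nat \<lfloor>16 ^ n * a\<rfloor>)) / 16 ^ n"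
    by (simp add: diff_divide_distrib)
  ultimately show ?thesis by simp
qed

lemma sqrt_scaled_le:
  fixes a \<delta> :: real
  assumes "0 \<le> \<delta>" "\<bar>a\<bar> \<le> 1 / 16 ^ n"
  shows "sqrt \<bar>\<delta> * a\<bar> \<le> sqrt \<delta> / 4 ^ n"
proof -
  have "sqrt \<bar>\<delta> * a\<bar> \<le> sqrt (\<delta> * (1 / 16 ^ n))"
    unfolding real_sqrt_le_iff abs_mult using assms by (intro mult_mono) auto
  also have "(16::real) ^ n = (4 ^ n)\<^sup>2"
    by (simp add: power2_eq_square power_mult_distrib[symmetric])
  finally show ?thesis by (simp add: real_sqrt_mult real_sqrt_divide)
qed

section \<open>Oscillation over one box\<close>

context stochastic_convolution
begin

text \<open>The grid of level \<open>n\<close> on the box with corner \<open>(1, x)\<close> and side \<open>\<delta>\<close> has mesh \<open>\<delta> / 16 ^ n\<close>,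
  so that the standard deviation of an increment to the parent point is of order \<open>2 ^ -n\<close>.\<close>

definition grid_value :: "real \<Rightarrow> real \<Rightarrow> nat \<Rightarrow> nat \<Rightarrow> nat \<Rightarrow> 'w \<Rightarrow> real" where
  "grid_value \<delta> x n i j = Z (1 + \<delta> * (real i / 16 ^ n)) (x + \<delta> * (real j / 16 ^ n))"

text \<open>The bad event of the chaining. The thresholds are summable in \<open>n\<close>, and the
  factor \<open>real n + 1\<close> makes the tail of a single jump decay fast enough to beat the
  number \<open>256 ^ Suc n\<close> of grid points.\<close>

definition grid_jump :: "real \<Rightarrow> real \<Rightarrow> real \<Rightarrow> 'w set" where
  "grid_jump \<rho> \<delta> x = {\<omega>\<in>space M. \<exists>n. \<exists>i<16 ^ Suc n. \<exists>j<16 ^ Suc n.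
     \<rho> * ((real n + 1) / 2 ^ n) < \<bar>grid_value \<delta> x (Suc n) i j \<omega> - grid_value \<delta> x n (i div 16) (j div 16) \<omega>\<bar>}"

lemma grid_value_measurable [measurable]: "grid_value \<delta> x n i j \<in> borel_measurable M"
  unfolding grid_value_def by measurable

lemma grid_jump_sets [measurable]: "grid_jump \<rho> \<delta> x \<in> sets M"
  unfolding grid_jump_def by measurable

text \<open>Both coordinates differ by at most \<open>\<delta> / 16 ^ n\<close>, whose square root
  is \<open>sqrt \<delta> / 4 ^ n\<close>. Time counts once and space 8 times in the variance bound,
  so 18 is twice 9.\<close>

lemma box_point_tail:
  assumes "0 < \<delta>" "\<delta> \<le> 1" "0 < r"
    and "a \<in> {0..1}" "c \<in> {0..1}" "a' \<in> {0..1}" "c' \<in> {0..1}"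
    and "\<bar>a - a'\<bar> \<le> 1 / 16 ^ n" "\<bar>c - c'\<bar> \<le> 1 / 16 ^ n"
  shows "prob {\<omega>\<in>space M. r < \<bar>Z (1 + \<delta> * a) (x + \<delta> * c) \<omega> - Z (1 + \<delta> * a') (x + \<delta> * c') \<omega>\<bar>}
     \<le> 2 * exp (- (r\<^sup>2 * 4 ^ n / (18 * sqrt \<delta>)))"
proof -
  have range: "1 + \<delta> * z \<in> {1..2}" if "z \<in> {0..1}" for z
    using that assms mult_mono[of \<delta> 1 z 1] by auto
  have "prob {\<omega>\<in>space M. r < \<bar>Z (1 + \<delta> * a) (x + \<delta> * c) \<omega> - Z (1 + \<delta> * a') (x + \<delta> * c') \<omega>\<bar>}
     \<le> 2 * exp (- (r\<^sup>2 / (2 * (9 * (sqrt \<delta> / 4 ^ n)))))"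
  proof (rule increment_tail)
    have "1 + \<delta> * a - (1 + \<delta> * a') = \<delta> * (a - a')" "x + \<delta> * c - (x + \<delta> * c') = \<delta> * (c - c')"
      by (simp_all add: algebra_simps)
    then show "sqrt \<bar>1 + \<delta> * a - (1 + \<delta> * a')\<bar> + 8 * sqrt \<bar>x + \<delta> * c - (x + \<delta> * c')\<bar> \<le> 9 * (sqrt \<delta> / 4 ^ n)"
      using sqrt_scaled_le[of \<delta> "a - a'" n] sqrt_scaled_le[of \<delta> "c - c'" n] assms by simp
  qed (use assms range in auto)
  then show ?thesis by simp
qed

text \<open>Union bound over all levels: level \<open>n\<close> costs at most twice
  \<open>?q ^ Suc n\<close> with \<open>?q \<le> 1 / 2\<close>, and the geometric series is at most
  \<open>4 * ?q\<close>. The rate \<open>m\<close> can be made large by taking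
  \<open>\<delta>\<close> small for a given \<open>\<beta>\<close>.\<close>

lemma grid_jump_prob:
  assumes "0 < \<delta>" "\<delta> \<le> 1" "0 < \<theta>" "0 < \<beta>" "18 * m * sqrt \<delta> \<le> \<beta>\<^sup>2" "512 * exp (- (m * \<theta>\<^sup>2)) \<le> 1"
  shows "prob (grid_jump (\<theta> * \<beta>) \<delta> x) \<le> 1024 * exp (- (m * \<theta>\<^sup>2))"
proof -
  let ?q = "256 * exp (- (m * \<theta>\<^sup>2))"
  define A where "A n i j = {\<omega>\<in>space M. (\<theta> * \<beta>) * ((real n + 1) / 2 ^ n)
     < \<bar>grid_value \<delta> x (Suc n) i j \<omega> - grid_value \<delta> x n (i div 16) (j div 16) \<omega>\<bar>}" for n i j
  define I where "I n = {..<16 ^ Suc n :: nat} \<times> {..<16 ^ Suc n :: nat}" for n :: nat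
  have [measurable]: "A n i j \<in> sets M" for n i j unfolding A_def by measurable
  have A: "prob (A n i j) \<le> 2 * exp (- (m * \<theta>\<^sup>2)) ^ Suc n" if "i < 16 ^ Suc n" "j < 16 ^ Suc n" for n i j
  proof -
    have unit: "real k / 16 ^ Suc n \<in> {0..1}" "real (k div 16) / 16 ^ n \<in> {0..1}" if "k < 16 ^ Suc n" for k
    proof -
      have "k div 16 < 16 ^ n" using that by (simp add: div_less_iff_less_mult mult.commute)
      then have "real (k div 16) \<le> real (16 ^ n)" "real k \<le> real (16 ^ Suc n)"
        using that by (simp_all only: of_nat_le_iff)
      then show "real k / 16 ^ Suc n \<in> {0..1}" "real (k div 16) / 16 ^ n \<in> {0..1}" by auto
    qed
    have "prob (A n i j) \<le> 2 * exp (- (((\<theta> * \<beta>) * ((real n + 1) / 2 ^ n))\<^sup>2 * 4 ^ n / (18 * sqrt \<delta>)))"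
      unfolding A_def grid_value_def using assms
      by (intro box_point_tail grid_parent_dist unit that) auto
    also have "((\<theta> * \<beta>) * ((real n + 1) / 2 ^ n))\<^sup>2 * 4 ^ n / (18 * sqrt \<delta>) = \<theta>\<^sup>2 * (real n + 1)\<^sup>2 * (\<beta>\<^sup>2 / (18 * sqrt \<delta>))"
    proof -
      have "(4::real) ^ n = (2 ^ n)\<^sup>2" by (simp add: power2_eq_square power_mult_distrib[symmetric])
      then show ?thesis by (simp add: power_mult_distrib power_divide)
    qed
    also have "2 * exp (- (\<theta>\<^sup>2 * (real n + 1)\<^sup>2 * (\<beta>\<^sup>2 / (18 * sqrt \<delta>)))) \<le> 2 * exp (- (m * \<theta>\<^sup>2)) ^ Suc n"
    proof -
      have "m \<le> \<beta>\<^sup>2 / (18 * sqrt \<delta>)"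
        using assms by (simp add: le_divide_eq mult.commute mult.left_commute)
      then have "\<theta>\<^sup>2 * (real n + 1) * m \<le> \<theta>\<^sup>2 * (real n + 1) * (\<beta>\<^sup>2 / (18 * sqrt \<delta>))"
        by (intro mult_left_mono) auto
      \<comment> \<open>One of the two factors \<open>real n + 1\<close> suffices, since it already
        turns the tail into a power with exponent \<open>Suc n\<close>.\<close>
      also have "\<dots> \<le> \<theta>\<^sup>2 * (real n + 1)\<^sup>2 * (\<beta>\<^sup>2 / (18 * sqrt \<delta>))"
        using assms by (intro mult_right_mono mult_left_mono) (auto simp: power2_eq_square)
      finally have "- (\<theta>\<^sup>2 * (real n + 1)\<^sup>2 * (\<beta>\<^sup>2 / (18 * sqrt \<delta>))) \<le> real (Suc n) * (- (m * \<theta>\<^sup>2))"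
        by (simp add: algebra_simps)
      then show ?thesis unfolding exp_of_nat_mult[symmetric] by simp
    qed
    finally show ?thesis .
  qed
  have B: "prob (\<Union>(i, j)\<in>I n. A n i j) \<le> 2 * ?q ^ Suc n" for n
  proof -
    have "prob (\<Union>(i, j)\<in>I n. A n i j) \<le> (\<Sum>p\<in>I n. prob (case p of (i, j) \<Rightarrow> A n i j))"
      by (intro finite_measure_subadditive_finite) (auto simp: I_def)
    also have "\<dots> \<le> (\<Sum>p\<in>I n. 2 * exp (- (m * \<theta>\<^sup>2)) ^ Suc n)"
      using A by (intro sum_mono) (auto simp: I_def)
    also have "\<dots> = (16 ^ Suc n * 16 ^ Suc n) * (2 * exp (- (m * \<theta>\<^sup>2)) ^ Suc n)"
      by (simp add: I_def card_cartesian_product)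
    also have "(16 ^ Suc n * 16 ^ Suc n :: real) = 256 ^ Suc n"
      unfolding power_mult_distrib[symmetric] by simp
    finally show ?thesis by (simp only: power_mult_distrib)
  qed
  have q: "0 < ?q" "?q \<le> 1 / 2" using assms by auto
  have sums: "(\<lambda>n. 2 * ?q ^ Suc n) sums (2 * ?q * (1 / (1 - ?q)))"
    using sums_mult[OF geometric_sums[of ?q], of "2 * ?q"] q by (simp add: mult.assoc)
  have summ: "summable (\<lambda>n. prob (\<Union>(i, j)\<in>I n. A n i j))"
    by (rule summable_comparison_test'[OF sums_summable[OF sums]]) (use B in auto)
  have "grid_jump (\<theta> * \<beta>) \<delta> x = (\<Union>n. \<Union>(i, j)\<in>I n. A n i j)"
    unfolding grid_jump_def A_def I_def by auto
  also have "prob \<dots> \<le> (\<Sum>n. prob (\<Union>(i, j)\<in>I n. A n i j))"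
    using summ by (intro finite_measure_subadditive_countably) (auto simp: I_def)
  also have "\<dots> \<le> (\<Sum>n. 2 * ?q ^ Suc n)"
    using B summ sums by (intro suminf_le) (auto simp: sums_iff)
  also have "\<dots> = 2 * ?q * (1 / (1 - ?q))"
    using sums by (simp add: sums_iff)
  also have "\<dots> \<le> 2 * ?q * 2"
    using q by (intro mult_left_mono) (auto simp: divide_le_eq)
  finally show ?thesis by simp
qed

text \<open>Telescoping along the base-16 digits of \<open>a\<close> and \<open>c\<close>, starting
  at level 0, whose only point is the corner \<open>(1, x)\<close>.\<close>

lemma grid_value_bound:
  fixes a c :: real
  assumes "\<omega> \<in> space M" "\<omega> \<notin> grid_jump \<rho> \<delta> x" "0 \<le> \<rho>" "a \<in> {0..<1}" "c \<in> {0..<1}"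
  shows "\<bar>grid_value \<delta> x n (nat \<lfloor>16 ^ n * a\<rfloor>) (nat \<lfloor>16 ^ n * c\<rfloor>) \<omega> - Z 1 x \<omega>\<bar> \<le> 4 * \<rho>"
proof -
  have less: "nat \<lfloor>16 ^ n * z\<rfloor> < 16 ^ n" if "z \<in> {0..<1}" for z :: real and n
  proof -
    have "\<lfloor>16 ^ n * z\<rfloor> < 16 ^ n" using that by (simp add: floor_less_iff)
    then show ?thesis using that by (simp add: nat_less_iff)
  qed
  have "\<bar>grid_value \<delta> x n (nat \<lfloor>16 ^ n * a\<rfloor>) (nat \<lfloor>16 ^ n * c\<rfloor>) \<omega> - Z 1 x \<omega>\<bar> \<le> (\<Sum>k<n. \<rho> * ((real k + 1) / 2 ^ k))"
  proof (induction n)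
    case 0
    have "\<lfloor>a\<rfloor> = 0" "\<lfloor>c\<rfloor> = 0" using assms by (simp_all add: floor_eq_iff)
    then show ?case by (simp add: grid_value_def)
  next
    case (Suc n)
    have "\<bar>grid_value \<delta> x (Suc n) (nat \<lfloor>16 ^ Suc n * a\<rfloor>) (nat \<lfloor>16 ^ Suc n * c\<rfloor>) \<omega>
        - grid_value \<delta> x n (nat \<lfloor>16 ^ Suc n * a\<rfloor> div 16) (nat \<lfloor>16 ^ Suc n * c\<rfloor> div 16) \<omega>\<bar> \<le> \<rho> * ((real n + 1) / 2 ^ n)"
      using assms(1,2) less[OF assms(4), of "Suc n"] less[OF assms(5), of "Suc n"]
      unfolding grid_jump_def by (force simp: not_less)
    moreover have "0 \<le> a" "0 \<le> c" using assms by auto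
    ultimately show ?case
      using Suc.IH by (simp add: nat_floor_div_16 del: power_Suc times_divide_eq_right) linarith
  qed
  also have "\<dots> = \<rho> * (4 - 2 * (real n + 2) / 2 ^ n)"
    unfolding sum_distrib_left[symmetric] sum_Suc_div_power2 ..
  also have "\<dots> \<le> \<rho> * 4"
    using assms by (intro mult_left_mono) auto
  finally show ?thesis by simp
qed

text \<open>The chain accounts for \<open>4 * \<rho>\<close>, the passage from its last grid point
  to the given point for the remaining \<open>\<rho>\<close>. Joint measurability of
  \<open>Z\<close> replaces continuity of paths: a bound that holds almost surely at each fixed
  point is turned into one for almost every point of the box.\<close>

lemma box_oscillation:
  assumes "0 < \<delta>" "\<delta> \<le> 1" "0 < \<rho>"
  shows "AE \<omega> in M. \<omega> \<notin> grid_jump \<rho> \<delta> x \<longrightarrow>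
     (AE p in lborel. p \<in> {1..<1 + \<delta>} \<times> {x..<x + \<delta>} \<longrightarrow> \<bar>Z (fst p) (snd p) \<omega> - Z 1 x \<omega>\<bar> \<le> 5 * \<rho>)"
proof -
  let ?P = "\<lambda>p \<omega>. \<omega> \<notin> grid_jump \<rho> \<delta> x \<longrightarrow> p \<in> {1..<1 + \<delta>} \<times> {x..<x + \<delta>} \<longrightarrow> \<bar>Z (fst p) (snd p) \<omega> - Z 1 x \<omega>\<bar> \<le> 5 * \<rho>"
  have point: "AE \<omega> in M. ?P p \<omega>" for p
  proof (cases "p \<in> {1..<1 + \<delta>} \<times> {x..<x + \<delta>}")
    case True
    define a c where "a = (fst p - 1) / \<delta>" and "c = (snd p - x) / \<delta>"
    have ac: "a \<in> {0..<1}" "c \<in> {0..<1}" and p: "fst p = 1 + \<delta> * a" "snd p = x + \<delta> * c"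
      using True assms by (auto simp: a_def c_def divide_less_eq)
    let ?B = "{\<omega>\<in>space M. \<omega> \<notin> grid_jump \<rho> \<delta> x \<and> \<not> \<bar>Z (fst p) (snd p) \<omega> - Z 1 x \<omega>\<bar> \<le> 5 * \<rho>}"
    \<comment> \<open>The event \<open>?B\<close> does not depend on \<open>n\<close>, while the
      bound tends to 0.\<close>
    have bound: "prob ?B \<le> 2 * exp (- (\<rho>\<^sup>2 * 4 ^ n / (18 * sqrt \<delta>)))" for n
    proof -
      let ?a = "real (nat \<lfloor>16 ^ n * a\<rfloor>) / 16 ^ n" and ?c = "real (nat \<lfloor>16 ^ n * c\<rfloor>) / 16 ^ n"
      have unit: "real (nat \<lfloor>16 ^ n * z\<rfloor>) / 16 ^ n \<in> {0..1}" if "z \<in> {0..<1}" for z :: real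
      proof -
        have "real (nat \<lfloor>16 ^ n * z\<rfloor>) \<le> 16 ^ n * z" using that by (simp add: of_nat_nat)
        also have "\<dots> \<le> 16 ^ n * 1" using that by (intro mult_left_mono) auto
        finally show ?thesis by simp
      qed
      have "prob ?B \<le> prob {\<omega>\<in>space M. \<rho> < \<bar>Z (1 + \<delta> * a) (x + \<delta> * c) \<omega> - Z (1 + \<delta> * ?a) (x + \<delta> * ?c) \<omega>\<bar>}"
      proof (intro finite_measure_mono subsetI)
        fix \<omega> assume w: "\<omega> \<in> ?B"
        then have "\<bar>Z (1 + \<delta> * ?a) (x + \<delta> * ?c) \<omega> - Z 1 x \<omega>\<bar> \<le> 4 * \<rho>"
          using grid_value_bound[of \<omega> \<rho> \<delta> x a c n] ac assms by (auto simp: grid_value_def)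
        then show "\<omega> \<in> {\<omega>\<in>space M. \<rho> < \<bar>Z (1 + \<delta> * a) (x + \<delta> * c) \<omega> - Z (1 + \<delta> * ?a) (x + \<delta> * ?c) \<omega>\<bar>}"
          using w unfolding p by auto
      qed measurable
      also have "\<dots> \<le> 2 * exp (- (\<rho>\<^sup>2 * 4 ^ n / (18 * sqrt \<delta>)))"
        using assms ac by (intro box_point_tail unit nat_floor_grid_dist) auto
      finally show ?thesis .
    qed
    have lim: "(\<lambda>n. 2 * exp (- (\<rho>\<^sup>2 * 4 ^ n / (18 * sqrt \<delta>)))) \<longlonglongrightarrow> 0"
      using assms by real_asymp
    have "prob ?B \<le> 0"
      by (rule LIMSEQ_le_const[OF lim]) (intro exI allI impI bound)
    then have "emeasure M ?B = 0"
      using measure_nonneg[of M ?B] by (simp add: emeasure_eq_measure)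
    then show ?thesis
      by (intro AE_I[of _ _ ?B]) auto
  qed auto
  \<comment> \<open>Fubini exchanges the two almost-everywhere quantifiers.\<close>
  interpret L: pair_sigma_finite lborel M ..
  have "{z \<in> space ((lborel :: (real \<times> real) measure) \<Otimes>\<^sub>M M). ?P (fst z) (snd z)} \<in> sets (lborel \<Otimes>\<^sub>M M)"
  proof -
    have [measurable]: "{1..<1 + \<delta>} \<times> {x..<x + \<delta>} \<in> sets (borel :: (real \<times> real) measure)"
      by (auto intro!: borel_Times)
    have [measurable]: "(\<lambda>z. Z (fst (fst z)) (snd (fst z)) (snd z)) \<in> borel_measurable ((lborel :: (real \<times> real) measure) \<Otimes>\<^sub>M M)"
      using joint_measurable by (simp add: split_beta' cong: measurable_cong_sets)
    show ?thesis by measurable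
  qed
  then have "(AE p in lborel. AE \<omega> in M. ?P p \<omega>) \<longleftrightarrow> (AE \<omega> in M. AE p in lborel. ?P p \<omega>)"
    by (rule L.AE_commute)
  then have "AE \<omega> in M. AE p in lborel. ?P p \<omega>" using point by simp
  then show ?thesis by eventually_elim auto
qed

section \<open>Boxes on which the noise is large\<close>

text \<open>The parameters balance all errors at the order
  \<open>exp (- (\<theta>\<^sup>2 * v))\<close>: the maximum over the points fails with weight 8,
  and the oscillations over the boxes with weight 2048. The condition on \<open>\<delta>\<close>
  does not involve \<open>\<theta>\<close>.\<close>

lemma large_on_some_box_prob:
  fixes \<theta> :: real
  defines "v \<equiv> heat_cov 1 0 1 0"
  assumes a: "0 < \<delta>" "\<delta> \<le> 1" "21600 * sqrt \<delta> \<le> v" "1 \<le> \<theta>" "512 * exp (- (3 * v * \<theta>\<^sup>2)) \<le> 1"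
  shows "\<exists>E\<in>events. prob E \<le> 2056 * exp (- (\<theta>\<^sup>2 * v)) \<and>
     (AE \<omega> in M. \<omega> \<notin> E \<longrightarrow>
        (\<exists>x. AE p in lborel. p \<in> {1..<1 + \<delta>} \<times> {x..<x + \<delta>} \<longrightarrow> \<theta> * v / 4 - 1 \<le> Z (fst p) (snd p) \<omega>))"
proof -
  have v: "heat_cov 1 x 1 x = v" "0 < v" for x
    by (auto simp: v_def heat_cov_diag)
  \<comment> \<open>With this many points the diagonal term of \<open>max_lower_tail\<close> is at
    most \<open>exp (- (\<theta>\<^sup>2 * v))\<close>, and a jump probability of order
    \<open>exp (- (3 * v * \<theta>\<^sup>2))\<close> per box is still affordable.\<close>
  define K where "K = nat \<lceil>exp (2 * \<theta>\<^sup>2 * v)\<rceil>"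
  have "1 \<le> exp (2 * \<theta>\<^sup>2 * v)" using v by simp
  then have K: "exp (2 * \<theta>\<^sup>2 * v) \<le> K" "K \<le> 2 * exp (2 * \<theta>\<^sup>2 * v)"
    unfolding K_def by linarith+
  then have "0 < real K" using less_le_trans[OF exp_gt_zero] by blast
  then have "0 < K" by simp
  \<comment> \<open>Solves \<open>exp (\<theta>\<^sup>2 * \<eta>) - 1 = exp (- (\<theta>\<^sup>2 *
    v))\<close>, the correlation term of \<open>max_lower_tail\<close>.\<close>
  define \<eta> where "\<eta> = ln (1 + exp (- (\<theta>\<^sup>2 * v))) / \<theta>\<^sup>2"
  have e_pos: "0 < 1 + exp (- (\<theta>\<^sup>2 * v))" by (simp add: add_pos_pos)
  have "0 < \<eta>" using a by (auto simp: \<eta>_def intro!: divide_pos_pos ln_gt_zero)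
  have \<eta>: "exp (\<theta>\<^sup>2 * \<eta>) - 1 = exp (- (\<theta>\<^sup>2 * v))"
    using a e_pos by (simp add: \<eta>_def)
  \<comment> \<open>A large spacing \<open>d\<close> pushes all covariances between distinct points
    below \<open>\<eta>\<close>.\<close>
  have "((\<lambda>d::real. exp (- (d\<^sup>2) / 8) * v) \<longlongrightarrow> 0) at_top" by real_asymp
  then have "eventually (\<lambda>d. exp (- (d\<^sup>2) / 8) * v < \<eta>) at_top"
    using \<open>0 < \<eta>\<close> by (auto simp: order_tendsto_iff)
  then have "eventually (\<lambda>d. 0 \<le> d \<and> exp (- (d\<^sup>2) / 8) * v < \<eta>) at_top"
    by (intro eventually_conj eventually_ge_at_top)
  then obtain d where d: "0 \<le> d" "exp (- (d\<^sup>2) / 8) * v < \<eta>"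
    by (auto simp: eventually_at_top_linorder)
  define \<xi> where "\<xi> k = real k * d" for k :: nat
  have far: "heat_cov 1 (\<xi> j) 1 (\<xi> k) \<le> \<eta>" if "j \<noteq> k" for j k
  proof -
    have "1 * d \<le> \<bar>real j - real k\<bar> * d"
      using that d by (intro mult_right_mono) auto
    also have "\<dots> = \<bar>\<xi> j - \<xi> k\<bar>"
      using d by (simp add: \<xi>_def left_diff_distrib[symmetric] abs_mult)
    finally have "d\<^sup>2 \<le> (\<xi> j - \<xi> k)\<^sup>2"
      using d by (metis abs_le_square_iff abs_of_nonneg mult_1)
    then have "exp (- ((\<xi> j - \<xi> k)\<^sup>2) / (8 * 1)) * v \<le> exp (- (d\<^sup>2) / 8) * v"
      using v by (intro mult_right_mono) auto
    then show ?thesis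
      using heat_cov_far[of 1 "\<xi> j" "\<xi> k", OF zero_less_one, unfolded v(1)] d(2) by linarith
  qed
  \<comment> \<open>The oscillation \<open>5 * \<rho>\<close> is then
    \<open>\<theta> * v / 4\<close>, half of the leading term \<open>\<theta> * v / 2\<close> of the
    maximum.\<close>
  define \<rho> where "\<rho> = \<theta> * (v / 20)"
  have "0 < \<rho>" using a v by (simp add: \<rho>_def)
  define E0 where "E0 = {\<omega>\<in>space M. \<forall>k<K. Z 1 (\<xi> k) \<omega> < \<theta> * v / 2 - ln 2 / \<theta>}"
  define E where "E = E0 \<union> (\<Union>k<K. grid_jump \<rho> \<delta> (\<xi> k))"
  have [measurable]: "E0 \<in> sets M" unfolding E0_def by measurable
  have "prob E0 \<le> 4 * (exp (\<theta>\<^sup>2 * v) / K + exp (\<theta>\<^sup>2 * \<eta>) - 1)"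
    unfolding E0_def v_def using far \<open>0 < K\<close> \<open>0 < \<eta>\<close> a by (intro max_lower_tail) auto
  also have "\<dots> \<le> 8 * exp (- (\<theta>\<^sup>2 * v))"
  proof -
    have "exp (\<theta>\<^sup>2 * v) / K \<le> exp (\<theta>\<^sup>2 * v) / exp (2 * \<theta>\<^sup>2 * v)"
      using K(1) \<open>0 < real K\<close> by (intro divide_left_mono mult_pos_pos) auto
    also have "\<dots> = exp (- (\<theta>\<^sup>2 * v))" unfolding exp_diff[symmetric] by simp
    finally show ?thesis using \<eta> by simp
  qed
  finally have E0: "prob E0 \<le> 8 * exp (- (\<theta>\<^sup>2 * v))" .
  have jump: "prob (grid_jump \<rho> \<delta> x) \<le> 1024 * exp (- (3 * v * \<theta>\<^sup>2))" for x
    unfolding \<rho>_def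
  proof (rule grid_jump_prob)
    \<comment> \<open>Here \<open>m = 3 * v\<close> and \<open>\<beta> = v / 20\<close>, and 21600
      is 18 times 3 times 400.\<close>
    have "18 * (3 * v) * sqrt \<delta> = (v / 400) * (21600 * sqrt \<delta>)" by simp
    also have "\<dots> \<le> (v / 400) * v" using a v by (intro mult_left_mono) auto
    finally show "18 * (3 * v) * sqrt \<delta> \<le> (v / 20)\<^sup>2" by (simp add: power2_eq_square)
  qed (use a v in auto)
  have "prob (\<Union>k<K. grid_jump \<rho> \<delta> (\<xi> k)) \<le> (\<Sum>k<K. prob (grid_jump \<rho> \<delta> (\<xi> k)))"
    by (intro finite_measure_subadditive_finite) auto
  also have "\<dots> \<le> (\<Sum>k<K. 1024 * exp (- (3 * v * \<theta>\<^sup>2)))"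
    by (intro sum_mono jump)
  also have "\<dots> \<le> (2 * exp (2 * \<theta>\<^sup>2 * v)) * (1024 * exp (- (3 * v * \<theta>\<^sup>2)))"
    using K(2) by (simp add: mult_right_mono)
  also have "\<dots> = 2048 * exp (- (\<theta>\<^sup>2 * v))"
    by (simp add: exp_add[symmetric] algebra_simps)
  finally have "prob E \<le> 2056 * exp (- (\<theta>\<^sup>2 * v))"
    using E0 measure_Un_le[of E0 M "\<Union>k<K. grid_jump \<rho> \<delta> (\<xi> k)"] unfolding E_def by simp
  moreover have "AE \<omega> in M. \<forall>k. \<omega> \<notin> grid_jump \<rho> \<delta> (\<xi> k) \<longrightarrow>
     (AE p in lborel. p \<in> {1..<1 + \<delta>} \<times> {\<xi> k..<\<xi> k + \<delta>} \<longrightarrow> \<bar>Z (fst p) (snd p) \<omega> - Z 1 (\<xi> k) \<omega>\<bar> \<le> 5 * \<rho>)"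
    unfolding AE_all_countable using box_oscillation[OF a(1,2) \<open>0 < \<rho>\<close>] by blast
  then have "AE \<omega> in M. \<omega> \<notin> E \<longrightarrow>
        (\<exists>x. AE p in lborel. p \<in> {1..<1 + \<delta>} \<times> {x..<x + \<delta>} \<longrightarrow> \<theta> * v / 4 - 1 \<le> Z (fst p) (snd p) \<omega>)"
    using AE_space
  proof eventually_elim
    case (elim \<omega>)
    show ?case
    proof
      assume "\<omega> \<notin> E"
      then obtain k where k: "k < K" "\<theta> * v / 2 - ln 2 / \<theta> \<le> Z 1 (\<xi> k) \<omega>" "\<omega> \<notin> grid_jump \<rho> \<delta> (\<xi> k)"
        using elim(2) unfolding E_def E0_def by (auto simp: not_less)
      have "ln 2 / \<theta> \<le> 1"
        using a ln_le_minus_one[of 2] by (simp add: divide_le_eq)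
      then have "\<theta> * v / 4 - 1 \<le> Z 1 (\<xi> k) \<omega> - 5 * \<rho>"
        using k(2) by (simp add: \<rho>_def)
      moreover have "AE p in lborel. p \<in> {1..<1 + \<delta>} \<times> {\<xi> k..<\<xi> k + \<delta>} \<longrightarrow> \<bar>Z (fst p) (snd p) \<omega> - Z 1 (\<xi> k) \<omega>\<bar> \<le> 5 * \<rho>"
        using elim(1) k(3) by blast
      ultimately have "AE p in lborel. p \<in> {1..<1 + \<delta>} \<times> {\<xi> k..<\<xi> k + \<delta>} \<longrightarrow> \<theta> * v / 4 - 1 \<le> Z (fst p) (snd p) \<omega>"
        by (auto elim!: eventually_mono)
      then show "\<exists>x. AE p in lborel. p \<in> {1..<1 + \<delta>} \<times> {x..<x + \<delta>} \<longrightarrow> \<theta> * v / 4 - 1 \<le> Z (fst p) (snd p) \<omega>" ..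
    qed
  qed
  moreover have "E \<in> events" unfolding E_def by measurable
  ultimately show ?thesis by blast
qed

text \<open>The side \<open>\<delta>\<close> is fixed first, from the variance alone. Then
  \<open>\<theta>\<close> runs through the integers: the failure probabilities tend to 0, so almost
  surely some \<open>\<theta>\<close> succeeds for each level. The position of the box may depend on
  \<open>\<omega>\<close>.\<close>

lemma large_on_some_box:
  obtains \<delta> where "0 < \<delta>" "\<delta> \<le> 1"
    "AE \<omega> in M. \<forall>n::nat. \<exists>x. AE p in lborel. p \<in> {1..<1 + \<delta>} \<times> {x..<x + \<delta>} \<longrightarrow> real n \<le> Z (fst p) (snd p) \<omega>"
proof
  define v where "v = heat_cov 1 0 1 0"
  have "0 < v" by (simp add: v_def heat_cov_diag)
  define \<delta> where "\<delta> = (min 1 (v / 21600))\<^sup>2"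
  have sqrt: "sqrt \<delta> = min 1 (v / 21600)" using \<open>0 < v\<close> by (simp add: \<delta>_def)
  show \<delta>: "0 < \<delta>" "\<delta> \<le> 1"
    using \<open>0 < v\<close> by (auto simp: \<delta>_def power_le_one)
  have sqrt_le: "21600 * sqrt \<delta> \<le> v" unfolding sqrt by (simp add: min_def)
  let ?good = "\<lambda>\<omega> (r::real). \<exists>x. AE p in lborel. p \<in> {1..<1 + \<delta>} \<times> {x..<x + \<delta>} \<longrightarrow> r \<le> Z (fst p) (snd p) \<omega>"
  have "AE \<omega> in M. ?good \<omega> (real n)" for n :: nat
  proof -
    have "eventually (\<lambda>m::nat. 512 * exp (- (3 * v * (real m)\<^sup>2)) \<le> 1) sequentially"
      using \<open>0 < v\<close> by real_asymp
    moreover have "eventually (\<lambda>m::nat. real n \<le> real m * v / 4 - 1) sequentially"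
      using \<open>0 < v\<close> by real_asymp
    ultimately have "eventually (\<lambda>m::nat. 1 \<le> real m \<and> 512 * exp (- (3 * v * (real m)\<^sup>2)) \<le> 1 \<and> real n \<le> real m * v / 4 - 1) sequentially"
      using eventually_ge_at_top[of "1::nat"] by eventually_elim auto
    then obtain m0 where m0: "\<And>m. m \<ge> m0 \<Longrightarrow> 1 \<le> real m \<and> 512 * exp (- (3 * v * (real m)\<^sup>2)) \<le> 1 \<and> real n \<le> real m * v / 4 - 1"
      by (auto simp: eventually_sequentially)
    have "\<forall>m. \<exists>E. E \<in> events \<and> (m0 \<le> m \<longrightarrow> prob E \<le> 2056 * exp (- ((real m)\<^sup>2 * v)) \<and>
       (AE \<omega> in M. \<omega> \<notin> E \<longrightarrow> ?good \<omega> (real m * v / 4 - 1)))"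
    proof
      fix m
      show "\<exists>E. E \<in> events \<and> (m0 \<le> m \<longrightarrow> prob E \<le> 2056 * exp (- ((real m)\<^sup>2 * v)) \<and>
         (AE \<omega> in M. \<omega> \<notin> E \<longrightarrow> ?good \<omega> (real m * v / 4 - 1)))"
      proof (cases "m0 \<le> m")
        case True
        then show ?thesis
          using large_on_some_box_prob[of \<delta> "real m"] \<delta> sqrt_le m0[of m] unfolding v_def by blast
      qed auto
    qed
    from choice[OF this] obtain E where "\<forall>m. E m \<in> events \<and> (m0 \<le> m \<longrightarrow> prob (E m) \<le> 2056 * exp (- ((real m)\<^sup>2 * v)) \<and>
       (AE \<omega> in M. \<omega> \<notin> E m \<longrightarrow> ?good \<omega> (real m * v / 4 - 1)))" ..
    then have E: "\<And>m. E m \<in> events"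
        "\<And>m. m0 \<le> m \<Longrightarrow> prob (E m) \<le> 2056 * exp (- ((real m)\<^sup>2 * v))"
        "\<And>m. m0 \<le> m \<Longrightarrow> AE \<omega> in M. \<omega> \<notin> E m \<longrightarrow> ?good \<omega> (real m * v / 4 - 1)"
      by simp_all
    \<comment> \<open>Outside this intersection at least one of the attempts
      \<open>\<theta> = m0 + m\<close> succeeds.\<close>
    let ?N = "\<Inter>m. E (m0 + m)"
    have N: "?N \<in> events" using E(1) by auto
    have lim: "(\<lambda>m::nat. 2056 * exp (- ((real (m0 + m))\<^sup>2 * v))) \<longlonglongrightarrow> 0"
      using \<open>0 < v\<close> by real_asymp
    have "prob ?N \<le> 2056 * exp (- ((real (m0 + m))\<^sup>2 * v))" for m
      using E(1) N by (intro order.trans[OF finite_measure_mono E(2)]) auto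
    then have "prob ?N \<le> 0"
      by (intro LIMSEQ_le_const[OF lim] exI allI impI)
    then have "?N \<in> null_sets M"
      using N measure_nonneg[of M ?N] by (auto simp: null_sets_def emeasure_eq_measure)
    then have "AE \<omega> in M. \<omega> \<notin> ?N" by (rule AE_not_in)
    moreover have "AE \<omega> in M. \<forall>m. \<omega> \<notin> E (m0 + m) \<longrightarrow> ?good \<omega> (real (m0 + m) * v / 4 - 1)"
      unfolding AE_all_countable by (intro allI E(3)) simp
    ultimately show ?thesis
    proof eventually_elim
      case (elim \<omega>)
      then obtain m where m: "?good \<omega> (real (m0 + m) * v / 4 - 1)" by blast
      have "real n \<le> real (m0 + m) * v / 4 - 1" using m0[of "m0 + m"] by simp
      then have imp: "real (m0 + m) * v / 4 - 1 \<le> z \<Longrightarrow> real n \<le> z" for z by linarith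
      from m obtain x where "AE p in lborel. p \<in> {1..<1 + \<delta>} \<times> {x..<x + \<delta>} \<longrightarrow> real (m0 + m) * v / 4 - 1 \<le> Z (fst p) (snd p) \<omega>" ..
      then have "AE p in lborel. p \<in> {1..<1 + \<delta>} \<times> {x..<x + \<delta>} \<longrightarrow> real n \<le> Z (fst p) (snd p) \<omega>"
        by eventually_elim (use imp in blast)
      then show ?case ..
    qed
  qed
  then show "AE \<omega> in M. \<forall>n::nat. ?good \<omega> (real n)"
    unfolding AE_all_countable by blast
qed

end

section \<open>Blow-up\<close>

text \<open>The product of the kernel bound \<open>exp (-1) / sqrt (4 * pi * \<tau>)\<close> and the
  length \<open>sqrt (\<tau> * \<delta>) / 2\<close>. The elapsed time \<open>\<tau>\<close>
  cancels, so the bound is uniform in it.\<close>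

definition interval_mass :: "real \<Rightarrow> real" where
  "interval_mass \<delta> = exp (-1) * sqrt \<delta> / (2 * sqrt (4 * pi))"

lemma interval_mass_pos: "0 < \<delta> \<Longrightarrow> 0 < interval_mass \<delta>"
  by (simp add: interval_mass_def)

text \<open>On a half-interval of length \<open>sqrt (\<tau> * \<delta>) / 2\<close> next to \<open>z\<close> the kernel is comparable to its maximum.\<close>

lemma heat_kernel_interval_mass:
  assumes "0 < \<tau>" "\<tau> \<le> \<delta>" "\<delta> \<le> 1" "z \<in> {x..<x + \<delta>}"
  shows "ennreal (interval_mass \<delta>) \<le> (\<integral>\<^sup>+ y. ennreal (heat_kernel \<tau> z y) * indicator {x..<x + \<delta>} y \<partial>lborel)"
proof -
  define w where "w = sqrt \<tau> * sqrt \<delta> / 2"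
  have "sqrt \<tau> * sqrt \<delta> \<le> sqrt \<delta> * sqrt \<delta>" using assms by (intro mult_right_mono) auto
  then have w: "0 \<le> w" "w \<le> \<delta> / 2" using assms by (auto simp: w_def)
  \<comment> \<open>Since \<open>w \<le> \<delta> / 2\<close>, at least one of the two sides of
    \<open>z\<close> has room for a piece of length \<open>w\<close>.\<close>
  define l where "l = (if z + w \<le> x + \<delta> then z else z - w)"
  have J: "{l..<l + w} \<subseteq> {x..<x + \<delta>}" and near: "\<And>y. y \<in> {l..<l + w} \<Longrightarrow> \<bar>z - y\<bar> \<le> w"
    using w assms by (auto simp: l_def split: if_splits)
  have kernel: "exp (-1) / sqrt (4 * pi * \<tau>) \<le> heat_kernel \<tau> z y" if "y \<in> {l..<l + w}" for y
  proof -
    have "(z - y)\<^sup>2 \<le> w\<^sup>2" using near[OF that] w(1) by (simp add: abs_le_square_iff[symmetric])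
    also have "w\<^sup>2 = \<tau> * \<delta> / 4" using assms by (simp add: w_def power_divide power_mult_distrib)
    also have "\<dots> \<le> \<tau> * 4" using mult_left_mono[of \<delta> 1 \<tau>] assms by simp
    finally have "(z - y)\<^sup>2 / (4 * \<tau>) \<le> 1" using assms by (simp add: divide_le_eq)
    then show ?thesis
      unfolding heat_kernel_def using assms by (intro divide_right_mono) auto
  qed
  have "interval_mass \<delta> = exp (-1) / sqrt (4 * pi * \<tau>) * w"
    using assms by (simp add: interval_mass_def w_def real_sqrt_mult)
  then have "ennreal (interval_mass \<delta>) = ennreal (exp (-1) / sqrt (4 * pi * \<tau>)) * emeasure lborel {l..<l + w}"
    using w assms by (simp add: ennreal_mult[symmetric])
  also have "\<dots> = (\<integral>\<^sup>+ y. ennreal (exp (-1) / sqrt (4 * pi * \<tau>)) * indicator {l..<l + w} y \<partial>lborel)"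
    by (simp add: nn_integral_cmult_indicator)
  also have "\<dots> \<le> (\<integral>\<^sup>+ y. ennreal (heat_kernel \<tau> z y) * indicator {x..<x + \<delta>} y \<partial>lborel)"
    using kernel J by (intro nn_integral_mono) (auto simp: indicator_def intro!: ennreal_leI)
  finally show ?thesis .
qed

text \<open>For \<open>s\<close> in \<open>{r..<r'}\<close> the elapsed time \<open>t - s\<close>
  lies strictly between 0 and \<open>\<delta>\<close>, so \<open>heat_kernel_interval_mass\<close>
  applies at every such time and is integrated.\<close>

lemma heat_kernel_slab_mass:
  assumes "1 \<le> r" "r \<le> r'" "r' \<le> t" "t < 1 + \<delta>" "\<delta> \<le> 1" "z \<in> {x..<x + \<delta>}"
  shows "ennreal ((r' - r) * interval_mass \<delta>)
     \<le> (\<integral>\<^sup>+ q. ennreal (heat_kernel (t - fst q) z (snd q)) * indicator ({r..<r'} \<times> {x..<x + \<delta>}) q \<partial>lborel)"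
proof -
  have "0 < \<delta>" using assms by auto
  let ?f = "\<lambda>q::real \<times> real. ennreal (heat_kernel (t - fst q) z (snd q)) * indicator ({r..<r'} \<times> {x..<x + \<delta>}) q"
  have [measurable]: "?f \<in> borel_measurable (borel \<Otimes>\<^sub>M borel)" by measurable
  have "ennreal ((r' - r) * interval_mass \<delta>) = (\<integral>\<^sup>+ s. ennreal (interval_mass \<delta>) * indicator {r..<r'} s \<partial>lborel)"
    using assms interval_mass_pos[OF \<open>0 < \<delta>\<close>]
    by (simp add: nn_integral_cmult_indicator ennreal_mult mult.commute)
  also have "\<dots> \<le> (\<integral>\<^sup>+ s. \<integral>\<^sup>+ y. ?f (s, y) \<partial>lborel \<partial>lborel)"
  proof (intro nn_integral_mono)
    fix s :: real
    show "ennreal (interval_mass \<delta>) * indicator {r..<r'} s \<le> (\<integral>\<^sup>+ y. ?f (s, y) \<partial>lborel)"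
      using heat_kernel_interval_mass[of "t - s" \<delta> z x] assms
      by (cases "s \<in> {r..<r'}") (auto simp: indicator_times)
  qed
  also have "\<dots> = (\<integral>\<^sup>+ q. ?f q \<partial>(lborel \<Otimes>\<^sub>M lborel))"
    by (intro lborel.nn_integral_fst) simp
  finally show ?thesis by (simp add: lborel_prod)
qed

section \<open>Discrete sums and the tail of the Osgood integral\<close>

lemma disjoint_family_consecutive_intervals:
  fixes t :: "nat \<Rightarrow> real"
  assumes "incseq t"
  shows "disjoint_family (\<lambda>j. {t j..<t (Suc j)})"
proof -
  have "{t i..<t (Suc i)} \<inter> {t j..<t (Suc j)} = {}" if "i < j" for i j
    using incseqD[OF assms, of "Suc i" j] that by auto
  then show ?thesis
    unfolding disjoint_family_on_def by (metis inf_commute linorder_neqE_nat)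
qed

lemma sum_disjoint_indicator_le:
  fixes f :: "'i \<Rightarrow> ennreal"
  assumes "finite I" "disjoint_family_on A I" "\<And>j. j \<in> I \<Longrightarrow> q \<in> A j \<Longrightarrow> f j \<le> X"
  shows "(\<Sum>j\<in>I. f j * indicator (A j) q) \<le> X"
proof (cases "\<exists>j\<in>I. q \<in> A j")
  case True
  then obtain j where j: "j \<in> I" "q \<in> A j" by blast
  then show ?thesis
    using sum_indicator_disjoint_family[OF assms(2) j(2) assms(1) j(1), of f] assms(3) by simp
qed simp

text \<open>The integrand of \<open>osgood\<close>. Its infinite value at zeros of \<open>b\<close>
  is what later forces \<open>b\<close> to be positive at the levels used.\<close>

definition osgood_density :: "(real \<Rightarrow> real) \<Rightarrow> real \<Rightarrow> ennreal" where
  "osgood_density b s = (if b s = 0 then \<infinity> else ennreal (1 / b s))"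

lemma osgood_density_antimono:
  assumes "\<forall>x. 0 \<le> b x" "mono_on {0<..} b" "0 < s" "s \<le> s'"
  shows "osgood_density b s' \<le> osgood_density b s"
proof (cases "b s = 0")
  case False
  have "b s \<le> b s'" using assms by (intro mono_onD[OF assms(2)]) auto
  moreover have "0 < b s" using False assms(1) by (simp add: less_le)
  ultimately show ?thesis
    by (auto simp: osgood_density_def intro!: ennreal_leI divide_left_mono)
qed (simp add: osgood_density_def)

text \<open>The integral test for a nonincreasing function: the value at \<open>N + real j\<close>
  is at most the integral over the unit interval to its left. The condition \<open>1 < N\<close>
  keeps these intervals in the half-line where \<open>b\<close> is monotone.\<close>

lemma sum_osgood_density_le:
  assumes "\<forall>x. 0 \<le> b x" "mono_on {0<..} b" "1 < N"
  shows "(\<Sum>j<k. osgood_density b (N + real j)) \<le> (\<integral>\<^sup>+ s. indicator {N - 1..} s * osgood_density b s \<partial>lborel)"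
proof -
  define t where "t j = N - 1 + real j" for j
  have "(\<Sum>j<k. osgood_density b (N + real j))
      = (\<Sum>j<k. \<integral>\<^sup>+ s. osgood_density b (N + real j) * indicator {t j..<t (Suc j)} s \<partial>lborel)"
    by (simp add: nn_integral_cmult_indicator t_def)
  also have "\<dots> = (\<integral>\<^sup>+ s. (\<Sum>j<k. osgood_density b (N + real j) * indicator {t j..<t (Suc j)} s) \<partial>lborel)"
    by (rule nn_integral_sum[symmetric]) simp
  also have "\<dots> \<le> (\<integral>\<^sup>+ s. indicator {N - 1..} s * osgood_density b s \<partial>lborel)"
  proof (intro nn_integral_mono sum_disjoint_indicator_le)
    show "disjoint_family_on (\<lambda>j. {t j..<t (Suc j)}) {..<k}"
      using disjoint_family_consecutive_intervals[of t]
      by (auto simp: t_def incseq_def disjoint_family_on_def)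
    fix s j assume "s \<in> {t j..<t (Suc j)}"
    then show "osgood_density b (N + real j) \<le> indicator {N - 1..} s * osgood_density b s"
      using assms by (auto simp: t_def intro!: osgood_density_antimono)
  qed simp
  finally show ?thesis .
qed

text \<open>Dominated convergence, with the finite integral from \<open>a\<close> as
  majorant.\<close>

lemma osgood_tail_small:
  assumes "osgood b" and [measurable]: "b \<in> borel_measurable borel" and "0 < \<epsilon>"
  obtains N where "1 < N" "(\<integral>\<^sup>+ s. indicator {N - 1..} s * osgood_density b s \<partial>lborel) < ennreal \<epsilon>"
proof -
  obtain a where a: "0 < a" "(\<integral>\<^sup>+ s. indicator {a..} s * osgood_density b s \<partial>lborel) < \<infinity>"
    using assms(1) unfolding osgood_def osgood_density_def by blast
  have [measurable]: "osgood_density b \<in> borel_measurable borel"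
    unfolding osgood_density_def[abs_def] by measurable
  have "(\<lambda>n. \<integral>\<^sup>+ s. indicator {a + real n..} s * osgood_density b s \<partial>lborel) \<longlonglongrightarrow> (\<integral>\<^sup>+ s. 0 \<partial>(lborel :: real measure))"
  proof (rule nn_integral_dominated_convergence[where w = "\<lambda>s. indicator {a..} s * osgood_density b s"])
    show "AE s in lborel. indicator {a + real n..} s * osgood_density b s \<le> indicator {a..} s * osgood_density b s" for n
      by (auto simp: indicator_def)
    show "AE s in lborel. (\<lambda>n. indicator {a + real n..} s * osgood_density b s) \<longlonglongrightarrow> 0"
    proof (intro AE_I2 tendsto_eventually)
      fix s :: real
      have "eventually (\<lambda>n. s - a < real n) sequentially"
        by (rule eventually_sequentiallyI[of "nat \<lceil>s - a\<rceil> + 1"]) linarith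
      then show "\<forall>\<^sub>F n in sequentially. indicator {a + real n..} s * osgood_density b s = 0"
        by eventually_elim (auto simp: indicator_def)
    qed
  qed (use a in auto)
  then have "eventually (\<lambda>n. (\<integral>\<^sup>+ s. indicator {a + real n..} s * osgood_density b s \<partial>lborel) < ennreal \<epsilon>) sequentially"
    using assms(3) by (auto simp: order_tendsto_iff)
  then obtain n where "(\<integral>\<^sup>+ s. indicator {a + real n..} s * osgood_density b s \<partial>lborel) < ennreal \<epsilon>"
    by (auto simp: eventually_sequentially)
  then show ?thesis using a(1) by (intro that[of "a + real n + 1"]) auto
qed

lemma locally_lipschitz_measurable:
  assumes "locally_lipschitz b"
  shows "b \<in> borel_measurable borel"
proof (rule borel_measurable_continuous_onI)
  show "continuous_on UNIV b"
    unfolding continuous_on_eq_continuous_at[OF open_UNIV]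
  proof
    fix x :: real
    obtain L where "L-lipschitz_on {- (\<bar>x\<bar> + 1)..\<bar>x\<bar> + 1} b"
      using assms unfolding locally_lipschitz_def by blast
    then have "continuous_on {- (\<bar>x\<bar> + 1)..\<bar>x\<bar> + 1} b" by (rule lipschitz_on_continuous_on)
    moreover have "x \<in> interior {- (\<bar>x\<bar> + 1)..\<bar>x\<bar> + 1}" by (simp add: interior_atLeastAtMost_real) linarith
    ultimately show "isCont b x" by (rule continuous_on_interior)
  qed
qed

section \<open>Explosion along a single path\<close>

text \<open>The mild formula is never restarted. Instead the drift integral is bounded below by the
  sum over the disjoint slabs between successive times \<open>t j\<close>: each contributes at least
  1, and the noise contributes \<open>N\<close>. The remaining parts of the formula are
  nonnegative.\<close>

lemma no_mild_solution_if_noise_large: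
  assumes "0 < \<delta>" "\<delta> \<le> 1" "1 < N"
    and b: "\<forall>x. 0 \<le> b x" "mono_on {0<..} b" and u0: "\<forall>x. 0 \<le> u0 x"
    and tail: "(\<integral>\<^sup>+ s. indicator {N - 1..} s * osgood_density b s \<partial>lborel) < ennreal (interval_mass \<delta> * \<delta>)"
    and large: "AE p in lborel. p \<in> {1..<1 + \<delta>} \<times> {x..<x + \<delta>} \<longrightarrow> N \<le> \<sigma> * Z (fst p) (snd p) \<omega>"
  shows "\<not> mild_solution_at b u0 \<sigma> Z u \<omega>"
proof
  assume mild: "mild_solution_at b u0 \<sigma> Z u \<omega>"
  let ?B = "{x..<x + \<delta>}"
  define c where "c = interval_mass \<delta>"
  have "0 < c" using assms by (simp add: c_def interval_mass_pos)
  define \<iota> where "\<iota> = enn2real (\<integral>\<^sup>+ s. indicator {N - 1..} s * osgood_density b s \<partial>lborel)"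
  have \<iota>: "(\<integral>\<^sup>+ s. indicator {N - 1..} s * osgood_density b s \<partial>lborel) = ennreal \<iota>" "0 \<le> \<iota>"
    using less_trans[OF tail ennreal_less_top] by (auto simp: \<iota>_def)
  have "\<iota> < c * \<delta>" using tail \<iota> \<open>0 < c\<close> assms by (simp add: c_def ennreal_less_iff)
  have sum_le: "(\<Sum>j<k. osgood_density b (N + real j)) \<le> ennreal \<iota>" for k
    using sum_osgood_density_le[OF b \<open>1 < N\<close>, of k] \<iota> by simp
  \<comment> \<open>A zero of \<open>b\<close> would make a summand infinite, against the finite
    bound.\<close>
  have b_pos: "0 < b (N + real j)" for j
  proof -
    have "osgood_density b (N + real j) \<le> (\<Sum>j<Suc j. osgood_density b (N + real j))"
      by simp
    also note sum_le
    finally have "b (N + real j) \<noteq> 0"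
      by (auto simp: osgood_density_def top_unique)
    then show ?thesis using b by (simp add: less_le)
  qed
  \<comment> \<open>The length of the \<open>j\<close>-th slab, times the kept mass rate
    \<open>c\<close>, times the drift \<open>b (N + real j)\<close>, is 1.\<close>
  define t where "t k = 1 + (\<Sum>j<k. 1 / (c * b (N + real j)))" for k
  have t_le: "t k \<le> 1 + \<iota> / c" for k
  proof -
    have eq: "ennreal (\<Sum>j<k. 1 / b (N + real j)) = (\<Sum>j<k. osgood_density b (N + real j))"
      using b_pos by (simp add: osgood_density_def less_imp_neq[symmetric] sum_ennreal b)
    have "(\<Sum>j<k. 1 / b (N + real j)) \<le> \<iota>"
      using sum_le[of k] unfolding eq[symmetric] ennreal_le_iff[OF \<iota>(2)] .
    moreover have "t k = 1 + (\<Sum>j<k. 1 / b (N + real j)) / c"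
      by (simp add: t_def sum_divide_distrib mult.commute)
    ultimately show ?thesis using \<open>0 < c\<close> by (simp add: divide_right_mono)
  qed
  have t_Suc: "t (Suc k) = t k + 1 / (c * b (N + real k))" for k by (simp add: t_def)
  have "incseq t"
    using b_pos \<open>0 < c\<close> by (intro incseq_SucI) (simp add: t_Suc less_imp_le)
  have "1 \<le> t k" for k
    using incseqD[OF \<open>incseq t\<close>, of 0 k] by (simp add: t_def)
  have level: "AE p in lborel. p \<in> {t k..<1 + \<delta>} \<times> ?B \<longrightarrow> N + real k \<le> u (fst p) (snd p) \<omega>" for k
  proof (induction k rule: less_induct)
    case (less k)
    have "AE p in lborel. \<forall>j\<in>{..<k}. p \<in> {t j..<1 + \<delta>} \<times> ?B \<longrightarrow> N + real j \<le> u (fst p) (snd p) \<omega>"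
      using less by (intro AE_finite_allI) auto
    note IH = this
    show ?case
      using large
    proof eventually_elim
      case (elim p)
      show ?case
      proof
        assume p: "p \<in> {t k..<1 + \<delta>} \<times> ?B"
        define \<tau> z where "\<tau> = fst p" and "z = snd p"
        have \<tau>: "t k \<le> \<tau>" "\<tau> < 1 + \<delta>" "0 < \<tau>" and z: "z \<in> ?B"
          using p \<open>1 \<le> t k\<close> by (auto simp: \<tau>_def z_def)
        let ?I = "{0<..<\<tau>} \<times> (UNIV :: real set)"
        let ?g = "\<lambda>q. heat_kernel (\<tau> - fst q) z (snd q) * b (u (fst q) (snd q) \<omega>)"
        let ?A = "\<lambda>j. {t j..<t (Suc j)} \<times> ?B"
        have int: "set_integrable lborel ?I ?g"
          and eq: "u \<tau> z \<omega> = (LINT y|lborel. heat_kernel \<tau> z y * u0 y) + (LINT q:?I|lborel. ?g q) + \<sigma> * Z \<tau> z \<omega>"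
          using mild \<tau> unfolding mild_solution_at_def by blast+
        have "ennreal (real k) = (\<Sum>j<k. ennreal (b (N + real j)) * ennreal ((t (Suc j) - t j) * c))"
        proof -
          have "ennreal (b (N + real j)) * ennreal ((t (Suc j) - t j) * c) = 1" for j
            using b_pos[of j] \<open>0 < c\<close> by (simp add: t_Suc ennreal_mult[symmetric])
          then show ?thesis by (simp add: ennreal_of_nat_eq_real_of_nat)
        qed
        also have "\<dots> \<le> (\<Sum>j<k. ennreal (b (N + real j)) *
            (\<integral>\<^sup>+ q. ennreal (heat_kernel (\<tau> - fst q) z (snd q)) * indicator (?A j) q \<partial>lborel))"
        proof (intro sum_mono mult_left_mono)
          fix j assume "j \<in> {..<k}"
          then have "t (Suc j) \<le> \<tau>" using incseqD[OF \<open>incseq t\<close>, of "Suc j" k] \<tau> by auto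
          then show "ennreal ((t (Suc j) - t j) * c)
             \<le> (\<integral>\<^sup>+ q. ennreal (heat_kernel (\<tau> - fst q) z (snd q)) * indicator (?A j) q \<partial>lborel)"
            unfolding c_def using \<tau> z assms(2) \<open>1 \<le> t j\<close> incseq_SucD[OF \<open>incseq t\<close>, of j]
            by (intro heat_kernel_slab_mass)
        qed simp
        also have "\<dots> = (\<integral>\<^sup>+ q. (\<Sum>j<k. (ennreal (b (N + real j)) * ennreal (heat_kernel (\<tau> - fst q) z (snd q))) * indicator (?A j) q) \<partial>lborel)"
        proof -
          have [measurable]: "?A j \<in> sets borel" for j by (auto intro!: borel_Times)
          have [measurable]: "(\<lambda>q. heat_kernel (\<tau> - fst q) z (snd q)) \<in> borel_measurable borel"
            unfolding borel_prod[symmetric] by measurable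
          show ?thesis
            unfolding mult.assoc by (subst nn_integral_sum) (simp_all add: nn_integral_cmult)
        qed
        \<comment> \<open>The induction hypothesis is used for almost every integration point
          \<open>q\<close>, not at \<open>p\<close>, so it suffices under the integral.\<close>
        also have "\<dots> \<le> (\<integral>\<^sup>+ q. ennreal (indicator ?I q *\<^sub>R ?g q) \<partial>lborel)"
        proof (rule nn_integral_mono_AE)
          show "AE q in lborel. (\<Sum>j<k. (ennreal (b (N + real j)) * ennreal (heat_kernel (\<tau> - fst q) z (snd q))) * indicator (?A j) q)
              \<le> ennreal (indicator ?I q *\<^sub>R ?g q)"
            using IH
          proof eventually_elim
            case (elim q)
            show ?case
            proof (rule sum_disjoint_indicator_le)
              show "disjoint_family_on ?A {..<k}"
                using disjoint_family_consecutive_intervals[OF \<open>incseq t\<close>]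
                unfolding disjoint_family_on_def by blast
              fix j assume j: "j \<in> {..<k}" and q: "q \<in> ?A j"
              have "t (Suc j) \<le> \<tau>" using incseqD[OF \<open>incseq t\<close>, of "Suc j" k] \<tau> j by auto
              then have fq: "0 < fst q" "fst q < \<tau>" "q \<in> {t j..<1 + \<delta>} \<times> ?B"
                using q \<open>1 \<le> t j\<close> \<tau> by auto
              then have "N + real j \<le> u (fst q) (snd q) \<omega>" using elim j by blast
              then have "b (N + real j) \<le> b (u (fst q) (snd q) \<omega>)"
                using \<open>1 < N\<close> by (intro mono_onD[OF b(2)]) auto
              then have "heat_kernel (\<tau> - fst q) z (snd q) * b (N + real j) \<le> ?g q"
                using fq by (intro mult_left_mono heat_kernel_nonneg) auto
              then show "ennreal (b (N + real j)) * ennreal (heat_kernel (\<tau> - fst q) z (snd q)) \<le> ennreal (indicator ?I q *\<^sub>R ?g q)"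
                using fq b by (auto simp: ennreal_mult'[symmetric] heat_kernel_nonneg indicator_def mem_Times_iff mult.commute intro!: ennreal_leI)
            qed simp
          qed
        qed
        also have "\<dots> = ennreal (LINT q:?I|lborel. ?g q)"
          unfolding set_lebesgue_integral_def using int b
          by (intro nn_integral_eq_integral)
             (auto simp: set_integrable_def indicator_def heat_kernel_nonneg intro!: AE_I2 mult_nonneg_nonneg)
        finally have "real k \<le> (LINT q:?I|lborel. ?g q)"
        proof -
          assume le: "ennreal (real k) \<le> ennreal (LINT q:?I|lborel. ?g q)"
          have "0 \<le> (LINT q:?I|lborel. ?g q)"
            unfolding set_lebesgue_integral_def using b
            by (intro Bochner_Integration.integral_nonneg) (auto simp: indicator_def heat_kernel_nonneg)
          then show ?thesis using le by (simp add: ennreal_le_iff)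
        qed
        moreover have "0 \<le> (LINT y|lborel. heat_kernel \<tau> z y * u0 y)"
          using \<tau> u0 by (intro Bochner_Integration.integral_nonneg) (simp add: heat_kernel_nonneg)
        moreover have "N \<le> \<sigma> * Z \<tau> z \<omega>"
          using elim p \<open>1 \<le> t k\<close> unfolding \<tau>_def z_def by (auto simp: mem_Times_iff)
        ultimately show "N + real k \<le> u (fst p) (snd p) \<omega>"
          using eq unfolding \<tau>_def z_def by linarith
      qed
    qed
  qed
  have "AE p in lborel. \<forall>k. p \<in> {t k..<1 + \<delta>} \<times> ?B \<longrightarrow> N + real k \<le> u (fst p) (snd p) \<omega>"
    unfolding AE_all_countable using level by blast
  \<comment> \<open>From time \<open>1 + \<iota> / c\<close> on all levels have been passed, which
    is impossible for a real value. The rectangle would be null, yet its area is positive since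
    \<open>\<iota> < c * \<delta>\<close>.\<close>
  then have "AE p in lborel. p \<notin> {1 + \<iota> / c..<1 + \<delta>} \<times> ?B"
  proof eventually_elim
    case (elim p)
    show ?case
    proof
      assume p: "p \<in> {1 + \<iota> / c..<1 + \<delta>} \<times> ?B"
      obtain k :: nat where "u (fst p) (snd p) \<omega> < real k" using reals_Archimedean2 by blast
      moreover have "N + real k \<le> u (fst p) (snd p) \<omega>"
        using elim p t_le[of k] by (auto simp: mem_Times_iff)
      ultimately show False using \<open>1 < N\<close> by linarith
    qed
  qed
  then have "{1 + \<iota> / c..<1 + \<delta>} \<times> ?B \<in> null_sets lborel"
    by (subst AE_iff_null_sets) (auto intro!: borel_Times)
  moreover have "emeasure lborel ({1 + \<iota> / c..<1 + \<delta>} \<times> ?B) = ennreal (\<delta> - \<iota> / c) * ennreal \<delta>"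
    using \<open>\<iota> < c * \<delta>\<close> \<open>0 < c\<close> assms(1)
    by (subst lborel_prod[symmetric], subst lborel.emeasure_pair_measure_Times) (auto simp: divide_le_eq mult.commute)
  moreover have "0 < \<delta> - \<iota> / c"
    using \<open>\<iota> < c * \<delta>\<close> \<open>0 < c\<close> by (simp add: divide_less_eq mult.commute)
  ultimately show False using assms(1) by (auto simp: null_sets_def)
qed

theorem theorem1p2:
  fixes M :: "'w measure"
    and W :: "(real \<times> real \<Rightarrow> real) \<Rightarrow> 'w \<Rightarrow> real"
    and F :: "real \<Rightarrow> 'w set set"
    and Z :: "real \<Rightarrow> real \<Rightarrow> 'w \<Rightarrow> real"
    and b u0 :: "real \<Rightarrow> real"
    and \<sigma> :: real
  assumes "\<sigma> > 0"
    and "white_noise M W"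
    and "noise_filtration M W F"
    and "stoch_conv_version M W Z"
    and "\<forall>x. 0 \<le> b x"
    and "locally_lipschitz b"
    and "mono_on {0<..} b"
    and "\<forall>x. 0 \<le> u0 x"
    and "continuous_on UNIV u0"
    and "osgood b"
  shows "\<forall>u. jm_adapted M F u \<longrightarrow> (AE \<omega> in M. \<not> mild_solution_at b u0 \<sigma> Z u \<omega>)"
proof (intro allI impI)
  fix u
  interpret stochastic_convolution M W Z
    using assms(2,4) by unfold_locales
  obtain \<delta> where \<delta>: "0 < \<delta>" "\<delta> \<le> 1"
    and large: "AE \<omega> in M. \<forall>n::nat. \<exists>x. AE p in lborel. p \<in> {1..<1 + \<delta>} \<times> {x..<x + \<delta>} \<longrightarrow> real n \<le> Z (fst p) (snd p) \<omega>"
    using large_on_some_box by blast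
  obtain N where N: "1 < N"
      "(\<integral>\<^sup>+ s. indicator {N - 1..} s * osgood_density b s \<partial>lborel) < ennreal (interval_mass \<delta> * \<delta>)"
    using osgood_tail_small[OF \<open>osgood b\<close> locally_lipschitz_measurable[OF \<open>locally_lipschitz b\<close>],
        of "interval_mass \<delta> * \<delta>"] \<delta> interval_mass_pos[of \<delta>] by auto
  obtain n :: nat where "N / \<sigma> < real n" using reals_Archimedean2 by blast
  then have n: "N \<le> \<sigma> * z" if "real n \<le> z" for z
    using that pos_divide_le_eq[OF \<open>\<sigma> > 0\<close>, of N z] by (simp add: mult.commute)
  \<comment> \<open>The exceptional null set comes from \<open>Z\<close> alone, so it is the same
    for every \<open>u\<close>.\<close>
  show "AE \<omega> in M. \<not> mild_solution_at b u0 \<sigma> Z u \<omega>"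
    using large
  proof eventually_elim
    case (elim \<omega>)
    then obtain x where "AE p in lborel. p \<in> {1..<1 + \<delta>} \<times> {x..<x + \<delta>} \<longrightarrow> real n \<le> Z (fst p) (snd p) \<omega>"
      by blast
    then have "AE p in lborel. p \<in> {1..<1 + \<delta>} \<times> {x..<x + \<delta>} \<longrightarrow> N \<le> \<sigma> * Z (fst p) (snd p) \<omega>"
      by eventually_elim (use n in blast)
    then show ?case
      by (rule no_mild_solution_if_noise_large[OF \<delta> N(1) assms(5,7,8) N(2)])
  qed
qed

end
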